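(* Let $\varphi_1:\mathbb{R}^d\to\mathbb{R}\cup\{\infty\}$ and $\varphi_2:\mathbb{R}^d\to\mathbb{R}$ be lower semicontinuous, put $\varphi:=\varphi_1+\varphi_2$, let $F:\mathbb{R}^d\to\mathbb{R}^d$ and let $x_0\in\operatorname{dom}\varphi$. Suppose there is an open set $\Omega\subset\mathbb{R}^d$ such that $\{x\in\mathbb{R}^d:\varphi(x)\le\varphi(x_0)\}\subset\Omega$, $\varphi_1$ is primal lower regular on $\Omega$, $\varphi_2$ is locally Lipschitz on $\Omega$, and $F$ is locally Lipschitz on $\Omega$. Let $x(\cdot)$ be an energetic solution of $$0\in\partial\varphi_1(x(t))+\partial\varphi_2(x(t))+DF(x(t))(\dot x(t))\ \text{ for a.e. } t\in\mathbb{R}_+,\qquad x(0)=x_0,$$ let $\omega(x)$ be the set of $z\in\mathbb{R}^d$ for which there is $t_n\to\infty$ with $x(t_n)\to z$, and suppose $x^\ast\in\omega(x)$ is such that the set-valued map $\partial\varphi_1+\partial\varphi_2$ is strongly metrically subregular at $(x^\ast,0)$ with modulus $\kappa>0$. Then $x(t)\to x^\ast$ as $t\to\infty$, and there exist $\sigma_0,T,\nu>0$ such that $$\sigma_0\int_s^t\|x(\tau)-x^\ast\|^2\,d\tau\le\varphi(x(s))-\varphi(x(t))\quad\text{for all }T\le s\le t,$$ $$\min_{s\in[T,t]}\|x(s)-x^\ast\|\le\frac{\nu}{\sqrt{t-T}}\quad\text{for all }t>T.$$ If, in addition, one of the following conditions holds: (i) $\varphi_1$ is weakly convex around $x^\ast$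 and $\varphi_2=0$; (ii) $\varphi_1=0$ and $-\varphi_2$ is weakly convex around $x^\ast$; then there exist $\alpha,\beta,\gamma,\tau>0$ such that for all $t\ge\tau$ $$\gamma\int_t^\infty\operatorname{dist}^2(0;\partial\varphi(x(s)))\,ds\le\varphi(x(t))-\varphi(x^\ast)\le\alpha\exp(-\beta t).$$ Moreover, in case (i), if $\varphi_1$ is $\sigma$-weakly convex around $x^\ast$ with $\sigma<\kappa^{-1}$, then there exist $\hat\alpha,\hat\beta,\hat\tau>0$ such that $\|x(t)-x^\ast\|\le\hat\alpha\exp(-\hat\beta t)$ for all $t\ge\hat\tau$.
   Context: $\mathbb{R}^d$ carries the Euclidean norm $\|\cdot\|$ and inner product $\langle\cdot,\cdot\rangle$; $\mathbb{R}_+=[0,\infty)$; $\mathbb{B}_r(x)$ is the open ball; $\operatorname{dom} f=\{x:f(x)<\infty\}$; $\operatorname{dist}(x;S)=\inf_{y\in S}\|x-y\|$ ($=\infty$ if $S=\emptyset$). Tangent cone: for $A\subset\mathbb{R}^m$ and $a\in A$, $T_A(a)$ is the set of $v$ for which there exist $t_n>0$, $t_n\to0$, $v_n\to v$ with $a+t_nv_n\in A$ for all $n$. Fréchet normal cone: $\widehat N_A(a)=\{v:\langle v,w\rangle\le0\ \forall w\in T_A(a)\}$. Clarke normal cone: $N_A(a)=\overline{\operatorname{co}}\{v:\exists\, a_n\in A,\ v_n\in\widehat N_A(a_n),\ (a_n,v_n)\to(a,v)\}$. Clarke subdifferential of a lower semicontinuous $f:\mathbb{R}^d\to\mathbb{R}\cup\{\infty\}$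 at $x$ with $f(x)<\infty$: $\partial f(x)=\{\zeta:(\zeta,-1)\in N_{\operatorname{epi}f}(x,f(x))\}$, where $\operatorname{epi}f=\{(x,\alpha):f(x)\le\alpha\}$; $\partial f(x)=\emptyset$ if $f(x)=\infty$; $\operatorname{dom}\partial f=\{x:\partial f(x)\ne\emptyset\}$. Primal lower regular (plr): $f$ is plr at $\bar x$ if there are $\varepsilon>0$, $c\ge0$ such that $f$ is lower semicontinuous on $\mathbb{B}_\varepsilon(\bar x)$ and for all $x\in\mathbb{B}_\varepsilon(\bar x)\cap\operatorname{dom}\partial f$ and all $\zeta\in\partial f(x)$, $f(y)\ge f(x)+\langle\zeta,y-x\rangle-c(1+\|\zeta\|)\|y-x\|^2$ for all $y\in\mathbb{B}_\varepsilon(\bar x)$. It is plr on an open set if it is plr at each of its points. Weak convexity: $f:\mathbb{R}^d\to\mathbb{R}\cup\{\infty\}$ is $\sigma$-weakly convex around $\bar x$ ($\sigma\ge0$) if there is a convex neighborhood $U$ of $\bar x$ with $f(\lambda x+(1-\lambda)y)\le\lambda f(x)+(1-\lambda)f(y)+\sigma\frac{\lambda(1-\lambda)}{2}\|x-y\|^2$ for all $x,y\in U$, $\lambda\in[0,1]$; weakly convex around $\bar x$ means this holds for some $\sigma\ge0$. Strong metric subregularity: a set-valued map $G:\mathbb{R}^d\rightrightarrows\mathbb{R}^d$ is strongly metrically subregular at $(\bar x,\bar y)\in\operatorname{gph}G$ with modulus $\kappa\ge0$ if there is a neighborhood $U$ of $\bar x$ with $\|x-\bar x\|\le\kappa\operatorname{dist}(\bar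 y;G(x))$ for all $x\in U$. Graphical derivative: $DF(x)(v)=\{u\in\mathbb{R}^d:(v,u)\in T_{\operatorname{gph}F}(x,F(x))\}$. Solution: $x:\mathbb{R}_+\to\mathbb{R}^d$ is a solution of the system if $x(0)=x_0$, $x$ is absolutely continuous on every compact interval of $\mathbb{R}_+$, and there exist $v,w\in L^2_{\rm loc}(\mathbb{R}_+;\mathbb{R}^d)$ with $v(t)\in\partial\varphi_1(x(t))$, $w(t)\in\partial\varphi_2(x(t))$ and $v(t)+w(t)\in-DF(x(t))(\dot x(t))$ for a.e. $t\in\mathbb{R}_+$. A solution is energetic if there exists $\rho>0$ such that $\rho\int_s^t\|\dot x(\tau)\|^2d\tau\le\varphi(x(s))-\varphi(x(t))$ for all $0\le s<t$. *)

theory Defs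
  imports "HOL-Analysis.Analysis"
begin

text \<open>Functions with values in the extended half-line (no value minus infinity) have type
  \<^typ>\<open>'a \<Rightarrow> ereal\<close>; the exclusion of \<^term>\<open>- \<infinity>\<close> is a separate hypothesis wherever it matters.\<close>

definition lsc_on :: "'a::metric_space set \<Rightarrow> ('a \<Rightarrow> ereal) \<Rightarrow> bool"
  where "lsc_on S f \<longleftrightarrow> (\<forall>x\<in>S. f x \<le> Liminf (at x within S) f)"

definition locally_lipschitz_on :: "'a::metric_space set \<Rightarrow> ('a \<Rightarrow> 'b::metric_space) \<Rightarrow> bool"
  where "locally_lipschitz_on S f \<longleftrightarrow>
    (\<forall>x\<in>S. \<exists>\<epsilon>>0. \<exists>L. L-lipschitz_on (ball x \<epsilon> \<inter> S) f)"

text \<open>Unlike \<^const>\<open>infdist\<close>, the distance to the empty set is infinite here.\<close>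

definition set_edist :: "'a::metric_space \<Rightarrow> 'a set \<Rightarrow> ennreal"
  where "set_edist x S = (INF y\<in>S. ennreal (dist x y))"

definition tangent_cone :: "'a::real_normed_vector set \<Rightarrow> 'a \<Rightarrow> 'a set"
  where "tangent_cone A a =
    {v. \<exists>(t::nat \<Rightarrow> real) w. (\<forall>n. t n > 0) \<and> t \<longlonglongrightarrow> 0 \<and> w \<longlonglongrightarrow> v \<and> (\<forall>n. a + t n *\<^sub>R w n \<in> A)}"

definition frechet_normal_cone :: "'a::real_inner set \<Rightarrow> 'a \<Rightarrow> 'a set"
  where "frechet_normal_cone A a = {v. \<forall>w\<in>tangent_cone A a. inner v w \<le> 0}"

definition clarke_normal_cone :: "'a::real_inner set \<Rightarrow> 'a \<Rightarrow> 'a set"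
  where "clarke_normal_cone A a = closure (convex hull
    {v. \<exists>a' v'. (\<forall>n::nat. a' n \<in> A \<and> v' n \<in> frechet_normal_cone A (a' n)) \<and>
      (\<lambda>n. (a' n, v' n)) \<longlonglongrightarrow> (a, v)})"

definition epi :: "('a \<Rightarrow> ereal) \<Rightarrow> ('a \<times> real) set"
  where "epi f = {(x, \<alpha>). f x \<le> ereal \<alpha>}"

definition clarke_subdifferential :: "('a::real_inner \<Rightarrow> ereal) \<Rightarrow> 'a \<Rightarrow> 'a set"
  where "clarke_subdifferential f x =
    (if f x < \<infinity> then {\<zeta>. (\<zeta>, - 1) \<in> clarke_normal_cone (epi f) (x, real_of_ereal (f x))} else {})"

definition primal_lower_regular_at :: "('a::real_inner \<Rightarrow> ereal) \<Rightarrow> 'a \<Rightarrow> bool"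
  where "primal_lower_regular_at f p \<longleftrightarrow>
    (\<exists>\<epsilon>>0. \<exists>c\<ge>0. lsc_on (ball p \<epsilon>) f \<and>
      (\<forall>x\<in>ball p \<epsilon>. \<forall>\<zeta>\<in>clarke_subdifferential f x. \<forall>y\<in>ball p \<epsilon>.
        f y \<ge> f x + ereal (inner \<zeta> (y - x) - c * (1 + norm \<zeta>) * (norm (y - x))\<^sup>2)))"

definition primal_lower_regular_on :: "'a::real_inner set \<Rightarrow> ('a \<Rightarrow> ereal) \<Rightarrow> bool"
  where "primal_lower_regular_on S f \<longleftrightarrow> (\<forall>p\<in>S. primal_lower_regular_at f p)"

text \<open>The endpoints \<^term>\<open>u = (0::real)\<close> and \<^term>\<open>u = (1::real)\<close> are harmless when \<^term>\<open>f\<close> is infinite,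
  since \<^term>\<open>0 * (\<infinity>::ereal) = 0\<close>.\<close>

definition weakly_convex_around :: "real \<Rightarrow> ('a::real_normed_vector \<Rightarrow> ereal) \<Rightarrow> 'a \<Rightarrow> bool"
  where "weakly_convex_around \<sigma> f p \<longleftrightarrow> \<sigma> \<ge> 0 \<and>
    (\<exists>U. convex U \<and> p \<in> interior U \<and>
      (\<forall>x\<in>U. \<forall>y\<in>U. \<forall>u\<in>{0..1}.
        f (u *\<^sub>R x + (1 - u) *\<^sub>R y) \<le>
          ereal u * f x + ereal (1 - u) * f y + ereal (\<sigma> * (u * (1 - u) / 2) * (norm (x - y))\<^sup>2)))"

definition strongly_metrically_subregular ::
    "('a::real_normed_vector \<Rightarrow> 'b::metric_space set) \<Rightarrow> 'a \<Rightarrow> 'b \<Rightarrow> real \<Rightarrow> bool"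
  where "strongly_metrically_subregular G p q \<kappa> \<longleftrightarrow> \<kappa> \<ge> 0 \<and>
    (\<exists>U. p \<in> interior U \<and> (\<forall>x\<in>U. ennreal (norm (x - p)) \<le> ennreal \<kappa> * set_edist q (G x)))"

definition graphical_derivative ::
    "('a::real_normed_vector \<Rightarrow> 'b::real_normed_vector) \<Rightarrow> 'a \<Rightarrow> 'a \<Rightarrow> 'b set"
  where "graphical_derivative F x v = {u. (v, u) \<in> tangent_cone {(y, F y) | y. True} (x, F x)}"

text \<open>The elements \<^term>\<open>K\<close> of a division are nonoverlapping nondegenerate or degenerate
  compact intervals with end points \<^term>\<open>Inf K\<close> and \<^term>\<open>Sup K\<close>.\<close>

definition absolutely_continuous_on_interval ::
    "real \<Rightarrow> real \<Rightarrow> (real \<Rightarrow> 'a::real_normed_vector) \<Rightarrow> bool"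
  where "absolutely_continuous_on_interval a b x \<longleftrightarrow>
    (\<forall>\<epsilon>>0. \<exists>\<delta>>0. \<forall>D S. D division_of S \<and> S \<subseteq> {a..b} \<and> (\<Sum>K\<in>D. Sup K - Inf K) < \<delta> \<longrightarrow>
      (\<Sum>K\<in>D. norm (x (Sup K) - x (Inf K))) < \<epsilon>)"

definition L2_loc :: "(real \<Rightarrow> 'a::euclidean_space) \<Rightarrow> bool"
  where "L2_loc v \<longleftrightarrow>
    (\<forall>T\<ge>0. v \<in> borel_measurable (lebesgue_on {0..T}) \<and>
      integrable (lebesgue_on {0..T}) (\<lambda>t. (norm (v t))\<^sup>2))"

text \<open>Trajectories are functions on the whole real line of which only the restriction to the
  nonnegative half-line matters.  An absolutely continuous curve is differentiable almost
  everywhere, so requiring the derivative \<^term>\<open>x'\<close> to exist below is no restriction.\<close>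

definition is_solution ::
    "('a::euclidean_space \<Rightarrow> ereal) \<Rightarrow> ('a \<Rightarrow> ereal) \<Rightarrow> ('a \<Rightarrow> 'a) \<Rightarrow> 'a \<Rightarrow> (real \<Rightarrow> 'a) \<Rightarrow> bool"
  where "is_solution \<phi>1 \<phi>2 F x0 x \<longleftrightarrow>
    x 0 = x0 \<and>
    (\<forall>a b. 0 \<le> a \<and> a \<le> b \<longrightarrow> absolutely_continuous_on_interval a b x) \<and>
    (\<exists>v w. L2_loc v \<and> L2_loc w \<and>
      (AE t in lebesgue. t \<ge> 0 \<longrightarrow>
        v t \<in> clarke_subdifferential \<phi>1 (x t) \<and> w t \<in> clarke_subdifferential \<phi>2 (x t) \<and>
        (\<exists>x'. (x has_vector_derivative x') (at t) \<and>
          v t + w t \<in> uminus ` graphical_derivative F (x t) x')))"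

text \<open>Integrability is stated explicitly because the Bochner integral of a nonintegrable
  function is 0.  If \<^term>\<open>\<phi> (x 0)\<close> is finite, the inequality for \<^term>\<open>s = (0::real)\<close> forces
  \<^term>\<open>\<phi> (x t)\<close> to be finite for every later time, so that no
  difference of infinities occurs.\<close>

definition energetic :: "('a::euclidean_space \<Rightarrow> ereal) \<Rightarrow> (real \<Rightarrow> 'a) \<Rightarrow> bool"
  where "energetic \<phi> x \<longleftrightarrow>
    (\<exists>\<rho>>0. \<forall>s t. 0 \<le> s \<and> s < t \<longrightarrow>
      integrable (lebesgue_on {s..t}) (\<lambda>r. (norm (vector_derivative x (at r)))\<^sup>2) \<and>
      ereal (\<rho> * (LINT r|lebesgue_on {s..t}. (norm (vector_derivative x (at r)))\<^sup>2))
        \<le> \<phi> (x s) - \<phi> (x t))"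

definition omega_limit_set :: "(real \<Rightarrow> 'a::topological_space) \<Rightarrow> 'a set"
  where "omega_limit_set x =
    {z. \<exists>t::nat \<Rightarrow> real. filterlim t at_top sequentially \<and> (\<lambda>n. x (t n)) \<longlonglongrightarrow> z}"

end

theory Submission
  imports Defs
begin

text \<open>Lipschitz continuity of \<open>F\<close> bounds elements of \<open>DF(x)(x')\<close> by a multiple of \<open>\<parallel>x'\<parallel>\<close>, so strong
  metric subregularity yields \<open>\<parallel>x(t) - x*\<parallel> \<le> K \<parallel>x'(t)\<parallel>\<close> almost everywhere near \<open>x*\<close>. Leaving a
  neighbourhood of \<open>x*\<close> therefore costs a fixed amount of energy, which can happen only finitely
  often; this gives convergence, and integrating the square of the bound gives the first rate.

  In case (i) the subgradient inequality at \<open>x(t)\<close>, and in case (ii) the supergradient inequality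
  at \<open>x*\<close> for the supergradient \<open>0\<close>, obtained as the limit of \<open>w(t)\<close> along times at which the
  speed tends to \<open>0\<close>, bound \<open>\<phi>(x(t)) - \<phi>(x*)\<close> by \<open>C \<parallel>x'(t)\<parallel>\<^sup>2\<close>. With the
  energy inequality the energy gap then contracts by a fixed factor over each unit of time.
  Finally \<open>\<parallel>x(t + 1) - x(t)\<parallel>\<close> is at most the square root of a multiple of the gap at time \<open>t\<close>,
  and summing the resulting geometric series bounds \<open>\<parallel>x(t) - x*\<parallel>\<close>.\<close>

section \<open>Absolutely continuous curves\<close>

text \<open>No chain rule for \<open>\<phi> (x t)\<close> is at hand: the energy is only known to
  drop, on every interval, by at least \<open>\<rho>\<close> times the action, the integral of the
  squared speed. All estimates therefore compare displacement, action and energy over intervals, and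
  decay is obtained from unit time steps instead of a differential inequality. Displacement is
  recovered from a derivative that exists almost everywhere by a fundamental theorem for the gauge
  integral.

  The value \<open>\<phi> xstar\<close> enters only as a lower bound of the energy, a consequence of
  lower semicontinuity; that the energy tends to it comes out of the decay.

  A separate obstacle is that the distance from \<open>0\<close> to the subdifferential must be
  measurable in time. This is drawn from closedness of the graph of the subdifferential near the
  limit point. Under weak convexity the subgradient inequality with quadratic defect holds on a
  whole neighbourhood, passes to limits and in turn implies being a Clarke subgradient. In case (ii)
  the Lipschitz property supplies compactness of normalised normals instead.\<close>

lemma division_length_le_measure:
  assumes D: "D division_of S" and sub: "S \<subseteq> T" and T: "T \<in> lmeasurable"
  shows "(\<Sum>K\<in>D. Sup K - Inf K) \<le> measure lebesgue (T :: real set)"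
proof -
  have "Sup K - Inf K = measure lebesgue K" if KD: "K \<in> D" for K
  proof -
    obtain u v where K: "K = cbox u v" "K \<noteq> {}"
      using division_ofD(3,4)[OF D KD] by blast
    then have "u \<le> v" by auto
    then show ?thesis
      by (simp add: K(1) interval_bounds_real)
  qed
  then have "(\<Sum>K\<in>D. Sup K - Inf K) = measure lebesgue S"
    using content_division[OF D] by simp
  also have "\<dots> \<le> measure lebesgue T"
    using lmeasurable_division[OF D] sub T by (intro measure_mono_fmeasurable) auto
  finally show ?thesis .
qed

lemma negligible_outer_open:
  fixes N :: "real set"
  assumes N: "negligible N" and "\<delta> > 0"
  obtains T where "open T" "N \<subseteq> T" "T \<in> lmeasurable" "measure lebesgue T < \<delta>"
proof -
  have null: "N \<in> null_sets lebesgue"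
    using N negligible_iff_null_sets by blast
  obtain T where T: "open T" "N \<subseteq> T" "T - N \<in> lmeasurable" "emeasure lebesgue (T - N) < ennreal \<delta>"
    using sets_lebesgue_outer_open[of N \<delta>] null \<open>\<delta> > 0\<close> by auto
  have emT: "emeasure lebesgue T < ennreal \<delta>"
    using emeasure_Diff_null_set[OF null, of T] T(1,4) by (simp add: borel_open)
  then have "T \<in> lmeasurable"
    using T(1) by (intro fmeasurableI) (auto simp: borel_open less_top intro: less_trans)
  moreover have "measure lebesgue T < \<delta>"
    using emT \<open>T \<in> lmeasurable\<close> \<open>\<delta> > 0\<close>
    by (metis emeasure_eq_measure2 ennreal_less_iff measure_nonneg)
  ultimately show ?thesis
    using T that by blast
qed

text \<open>The tags in the exceptional null set are kept inside an open set of small measure, where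
  absolute continuity controls the increments; the remaining tags obey the straddle estimate.\<close>

theorem fundamental_theorem_of_calculus_absolutely_continuous:
  fixes f :: "real \<Rightarrow> 'a::euclidean_space"
  assumes ac: "absolutely_continuous_on_interval a b f" and "a \<le> b" and N: "negligible N"
    and deriv: "\<And>t. t \<in> {a..b} - N \<Longrightarrow> (f has_vector_derivative f' t) (at t within {a..b})"
  shows "(f' has_integral (f b - f a)) {a..b}"
proof -
  \<comment> \<open>Exceptional tags get the value \<open>0\<close>, so that their terms in the
    Riemann sum reduce to increments of \<open>f\<close>.\<close>
  define g where "g t = (if t \<in> N then 0 else f' t)" for t
  have "(g has_integral (f b - f a)) (cbox a b)"
    unfolding has_integral
  proof (intro allI impI)
    fix e :: real assume "e > 0"
    \<comment> \<open>Half of the error is spread over the length of the interval; the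
      \<open>+ 1\<close> covers \<open>a = b\<close>.\<close>
    define \<eta> where "\<eta> = e / (2 * (b - a + 1))"
    have "\<eta> > 0" using \<open>e > 0\<close> \<open>a \<le> b\<close> by (simp add: \<eta>_def)
    obtain \<delta> where "\<delta> > 0" and \<delta>: "\<And>D S. \<lbrakk>D division_of S; S \<subseteq> {a..b}; (\<Sum>K\<in>D. Sup K - Inf K) < \<delta>\<rbrakk>
        \<Longrightarrow> (\<Sum>K\<in>D. norm (f (Sup K) - f (Inf K))) < e / 2"
      using ac \<open>e > 0\<close> unfolding absolutely_continuous_on_interval_def
      by (metis half_gt_zero)
    obtain T where T: "open T" "N \<subseteq> T" "T \<in> lmeasurable" "measure lebesgue T < \<delta>"
      using negligible_outer_open[OF N \<open>\<delta> > 0\<close>] .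
    have "\<exists>d>0. t \<in> {a..b} \<longrightarrow> (if t \<in> N then ball t d \<subseteq> T else
         (\<forall>y\<in>{a..b}. norm (y-t) < d \<longrightarrow> norm (f y - f t - (y-t) *\<^sub>R g t) \<le> \<eta> * norm (y-t)))" for t
    proof (cases "t \<in> N")
      case True
      then show ?thesis using T by (metis openE subsetD)
    next
      case False
      have "\<exists>d>0. \<forall>y\<in>{a..b}. norm (y-t) < d \<longrightarrow> norm (f y - f t - (y-t) *\<^sub>R f' t) \<le> \<eta> * norm (y-t)"
        if "t \<in> {a..b}"
        using deriv[of t] \<open>\<eta> > 0\<close> False that
        unfolding has_vector_derivative_def has_derivative_within_alt by blast
      then show ?thesis
        by (cases "t \<in> {a..b}") (auto simp: g_def False intro: zero_less_one)
    qed
    then obtain d where d: "\<And>t. 0 < d t"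
        "\<And>t. t \<in> {a..b} \<Longrightarrow> t \<in> N \<Longrightarrow> ball t (d t) \<subseteq> T"
        "\<And>t y. \<lbrakk>t \<in> {a..b}; t \<notin> N; y \<in> {a..b}; norm (y-t) < d t\<rbrakk>
          \<Longrightarrow> norm (f y - f t - (y-t) *\<^sub>R g t) \<le> \<eta> * norm (y-t)"
      by metis
    show "\<exists>\<gamma>. gauge \<gamma> \<and> (\<forall>p. p tagged_division_of (cbox a b) \<and> \<gamma> fine p \<longrightarrow>
      norm ((\<Sum>(x, k)\<in>p. measure lborel k *\<^sub>R g x) - (f b - f a)) < e)"
    proof (intro exI conjI allI impI)
      show "gauge (\<lambda>x. ball x (d x))"
        using d(1) gauge_ball_dependent by blast
      fix p assume "p tagged_division_of (cbox a b) \<and> (\<lambda>x. ball x (d x)) fine p"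
      then have ptag: "p tagged_division_of (cbox a b)" and finep: "(\<lambda>x. ball x (d x)) fine p"
        by auto
      define P where "P = {(t, K) \<in> p. t \<in> N}"
      have fin: "finite p" using ptag by blast
      have Pp: "P \<subseteq> p" by (auto simp: P_def)
      have Psnd: "snd ` P division_of \<Union>(snd ` P)"
        by (meson Pp partial_division_of_tagged_division ptag tagged_division_of_def
            tagged_partial_division_subset)
      have ba: "b - a = (\<Sum>(x,K)\<in>p. Sup K - Inf K)"
          "f b - f a = (\<Sum>(x,K)\<in>p. f(Sup K) - f(Inf K))"
        using additive_tagged_division_1[where f= "\<lambda>x. x"] additive_tagged_division_1[where f= f]
              \<open>a \<le> b\<close> ptag by auto
      have PT: "\<Union>(snd ` P) \<subseteq> T"
      proof -
        have "K \<subseteq> T" if "(t, K) \<in> P" for t K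
        proof -
          have tK: "(t, K) \<in> p" "t \<in> N" using that by (auto simp: P_def)
          then have "t \<in> {a..b}" using tag_in_interval[OF ptag] by auto
          then show ?thesis
            using d(2)[OF _ tK(2)] finep tK(1) unfolding fine_def by blast
        qed
        then show ?thesis by (fastforce simp: image_iff)
      qed
      have "\<Union>(snd ` P) \<subseteq> {a..b}"
        using ptag Pp by (fastforce dest: tagged_division_ofD(3))
      moreover have "(\<Sum>K\<in>snd ` P. Sup K - Inf K) < \<delta>"
        using division_length_le_measure[OF Psnd PT T(3)] T(4) by linarith
      ultimately have small: "(\<Sum>K\<in>snd ` P. norm (f (Sup K) - f (Inf K))) < e / 2"
        by (intro \<delta>[OF Psnd])
      have sumP: "(\<Sum>(t, K)\<in>P. norm (f (Sup K) - f (Inf K))) = (\<Sum>K\<in>snd ` P. norm (f (Sup K) - f (Inf K)))"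
      proof -
        \<comment> \<open>Passing from tags to intervals requires the value \<open>0\<close> on
          every box with empty interior, including the empty one, whose \<open>Sup\<close> and
          \<open>Inf\<close> carry no information; hence the case distinction.\<close>
        define \<Delta> where "\<Delta> K = (if K = {} then 0 else norm (f (Sup K) - f (Inf K)))" for K
        have "(\<Sum>(t, K)\<in>P. \<Delta> K) = (\<Sum>K\<in>snd ` P. \<Delta> K)"
        proof (rule sum.over_tagged_division_lemma)
          show "P tagged_division_of \<Union>(snd ` P)"
            by (meson Pp ptag tagged_division_of_def tagged_partial_division_of_Union_self
              tagged_partial_division_subset)
          fix u v :: real assume "box u v = {}"
          then show "\<Delta> (cbox u v) = 0"
            by (cases "u = v") (auto simp: \<Delta>_def)
        qed
        moreover have "K \<noteq> {}" if "(t, K) \<in> P" for t K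
          using that Pp ptag by blast
        then have "(\<Sum>(t, K)\<in>P. \<Delta> K) = (\<Sum>(t, K)\<in>P. norm (f (Sup K) - f (Inf K)))"
            "(\<Sum>K\<in>snd ` P. \<Delta> K) = (\<Sum>K\<in>snd ` P. norm (f (Sup K) - f (Inf K)))"
          by (fastforce simp: \<Delta>_def intro!: sum.cong)+
        ultimately show ?thesis by simp
      qed
      have "norm ((\<Sum>(x, K) \<in> p. measure lborel K *\<^sub>R g x) - (f b - f a))
         = norm (\<Sum>(x, K) \<in> p. measure lborel K *\<^sub>R g x - (f (Sup K) - f (Inf K)))"
        by (simp add: ba split_def sum_subtractf)
      also have "\<dots> \<le> (\<Sum>(x, K)\<in>p. norm (measure lborel K *\<^sub>R g x - (f (Sup K) - f (Inf K))))"
        unfolding split_def by (rule norm_sum)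
      also have "\<dots> \<le> (\<Sum>(x, K)\<in>p. \<eta> * (Sup K - Inf K) +
          (if x \<in> N then norm (f (Sup K) - f (Inf K)) else 0))"
      proof (rule sum_mono, clarify)
        fix x K
        assume "(x, K) \<in> p"
        then have "x \<in> K" and kab: "K \<subseteq> cbox a b"
          using ptag by blast+
        then obtain u v where k: "K = cbox u v"
          using ptag \<open>(x, K) \<in> p\<close> by auto 
        have "u \<le> v" using \<open>x \<in> K\<close> unfolding k by auto
        have ball: "\<forall>y\<in>K. y \<in> ball x (d x)"
          using finep \<open>(x, K) \<in> p\<close> by blast
        have uv: "u \<in> K" "v \<in> K"
          by (simp_all add: \<open>u \<le> v\<close> k)
        have xab: "x \<in> {a..b}" "u \<in> {a..b}" "v \<in> {a..b}" using \<open>x \<in> K\<close> uv kab by auto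
        show "norm (measure lborel K *\<^sub>R g x - (f (Sup K) - f (Inf K))) \<le> \<eta> * (Sup K - Inf K) +
          (if x \<in> N then norm (f (Sup K) - f (Inf K)) else 0)"
        proof (cases "x \<in> N")
          case True
          then show ?thesis
            using \<open>\<eta> > 0\<close> \<open>u \<le> v\<close> by (simp add: g_def k norm_minus_commute)
        next
          case False
          have "norm ((v - u) *\<^sub>R g x - (f v - f u)) =
              norm (f u - f x - (u - x) *\<^sub>R g x - (f v - f x - (v - x) *\<^sub>R g x))"
            by (auto simp: algebra_simps)
          also have "\<dots> \<le> norm (f u - f x - (u - x) *\<^sub>R g x) + norm (f v - f x - (v - x) *\<^sub>R g x)"
            by (rule norm_triangle_ineq4)
          also have "\<dots> \<le> \<eta> * norm (u - x) + \<eta> * norm (v - x)"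
            using uv ball by (intro add_mono d(3)[OF xab(1) False] xab) (auto simp: dist_real_def)
          also have "\<dots> \<le> \<eta> * (v - u)"
            using \<open>x \<in> K\<close> by (auto simp: k field_simps)
          finally show ?thesis
            using False \<open>u \<le> v\<close> by (simp add: k)
        qed
      qed
      also have "\<dots> = \<eta> * (b - a) + (\<Sum>(x, K)\<in>P. norm (f (Sup K) - f (Inf K)))"
      proof -
        have "(\<Sum>(x, K)\<in>p. if x \<in> N then norm (f (Sup K) - f (Inf K)) else 0)
            = (\<Sum>(x, K)\<in>P. norm (f (Sup K) - f (Inf K)))"
          unfolding P_def by (rule sum.mono_neutral_cong_right) (use fin in \<open>auto split: if_splits\<close>)
        then show ?thesis
          by (simp add: split_def sum.distrib ba(1) sum_distrib_left)
      qed
      also have "\<dots> < e"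
      proof -
        have "\<eta> * (b - a) \<le> \<eta> * (b - a + 1)" using \<open>\<eta> > 0\<close> by simp
        also have "\<dots> = e / 2"
        proof -
          have "e / (2 * k) * k = e / 2" if "k \<noteq> 0" for k :: real using that by simp
          then show ?thesis unfolding \<eta>_def by this (use \<open>a \<le> b\<close> in simp)
        qed
        finally show ?thesis using small sumP by linarith
      qed
      finally show "norm ((\<Sum>(x, k)\<in>p. measure lborel k *\<^sub>R g x) - (f b - f a)) < e" .
    qed
  qed
  then show ?thesis
    using has_integral_spike_eq[OF N, of "{a..b}" g f'] by (simp add: g_def)
qed

lemma absolutely_continuous_on_interval_imp_continuous_on:
  assumes "absolutely_continuous_on_interval a b f"
  shows "continuous_on {a..b} f"
  unfolding continuous_on_iff
proof (intro ballI allI impI)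
  fix s and e :: real assume s: "s \<in> {a..b}" and "e > 0"
  then obtain \<delta> where "\<delta> > 0" and \<delta>: "\<And>D S. \<lbrakk>D division_of S; S \<subseteq> {a..b}; (\<Sum>K\<in>D. Sup K - Inf K) < \<delta>\<rbrakk>
      \<Longrightarrow> (\<Sum>K\<in>D. norm (f (Sup K) - f (Inf K))) < e"
    using assms unfolding absolutely_continuous_on_interval_def by metis
  have *: "norm (f v - f u) < e" if "u \<in> {a..b}" "v \<in> {a..b}" "u \<le> v" "v - u < \<delta>" for u v
    using \<delta>[of "{cbox u v}" "cbox u v"] division_of_self[of u v] that by auto
  have "dist (f t) (f s) < e" if "t \<in> {a..b}" "dist t s < \<delta>" for t
    using *[of s t] *[of t s] s that
    by (cases "s \<le> t") (auto simp: dist_norm norm_minus_commute)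
  with \<open>\<delta> > 0\<close> show "\<exists>d>0. \<forall>t\<in>{a..b}. dist t s < d \<longrightarrow> dist (f t) (f s) < e"
    by blast
qed

text \<open>Only the open interval is constrained, because later bounds hold strictly between an
  entrance time and an exit time; the end points join the null set. Resetting derivative and bound
  to \<open>0\<close> on that set makes the comparison valid at every point.\<close>

lemma norm_increment_le_integral:
  fixes f :: "real \<Rightarrow> 'a::euclidean_space"
  assumes ac: "absolutely_continuous_on_interval a b f" and "a \<le> b"
    and AE: "AE t in lebesgue. a < t \<and> t < b \<longrightarrow>
      f differentiable (at t) \<and> norm (vector_derivative f (at t)) \<le> g t"
    and g: "g integrable_on {a..b}"
  shows "norm (f b - f a) \<le> integral {a..b} g"
proof -
  obtain N0 where N0: "N0 \<in> null_sets lebesgue"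
    "\<And>t. t \<notin> N0 \<Longrightarrow> a < t \<and> t < b \<longrightarrow>
      f differentiable (at t) \<and> norm (vector_derivative f (at t)) \<le> g t"
    using AE by (rule AE_E3) auto
  define N where "N = insert a (insert b N0)"
  have N: "negligible N"
    using N0(1) by (simp add: N_def negligible_iff_null_sets[symmetric])
  have good: "f differentiable (at t)" "norm (vector_derivative f (at t)) \<le> g t"
    if "t \<in> {a..b} - N" for t
    using N0(2)[of t] that by (auto simp: N_def)
  define h where "h t = (if t \<in> N then 0 else vector_derivative f (at t))" for t
  define g' where "g' t = (if t \<in> N then 0 else g t)" for t
  have h: "(h has_integral f b - f a) {a..b}"
  proof (rule fundamental_theorem_of_calculus_absolutely_continuous[OF ac \<open>a \<le> b\<close> N])
    fix t assume t: "t \<in> {a..b} - N"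
    then show "(f has_vector_derivative h t) (at t within {a..b})"
      using good(1)[OF t] by (simp add: h_def vector_derivative_works has_vector_derivative_at_within)
  qed
  have g': "(g' has_integral integral {a..b} g) {a..b}"
    using has_integral_spike_eq[OF N, of "{a..b}" g' g] integrable_integral[OF g]
    by (simp add: g'_def)
  have "norm (integral {a..b} h) \<le> integral {a..b} g'"
    using h g' good by (intro integral_norm_bound_integral) (auto simp: h_def g'_def)
  then show ?thesis
    using h g' by (simp add: integral_unique)
qed

section \<open>Clarke subgradients\<close>

lemma lsc_onD_eventually:
  fixes f :: "'a::metric_space \<Rightarrow> ereal"
  assumes "lsc_on UNIV f" "y \<longlonglongrightarrow> z" "m < f z"
  shows "\<forall>\<^sub>F n in sequentially. m < f (y n)"
proof -
  have "\<forall>\<^sub>F u in at z. m < f u"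
    using assms(1,3) unfolding lsc_on_def le_Liminf_iff by blast
  \<comment> \<open>\<open>Liminf\<close> over \<open>at z\<close> disregards \<open>z\<close>
    itself, whereas the sequence may hit it.\<close>
  then have "\<forall>\<^sub>F u in nhds z. m < f u"
    using assms(3) by (auto simp: eventually_at_filter elim: eventually_mono)
  then show ?thesis
    using assms(2) by (rule eventually_compose_filterlim)
qed

text \<open>The bound is split as \<open>m = k + (m - k)\<close> with \<open>k\<close> strictly
  between \<open>m - g z\<close> and \<open>f z\<close>; such a real \<open>k\<close> also exists
  when \<open>f z\<close> is infinite.\<close>

lemma eventually_less_add_lsc:
  fixes f :: "'a::metric_space \<Rightarrow> ereal" and g :: "'a \<Rightarrow> real"
  assumes "lsc_on UNIV f" "lsc_on UNIV (\<lambda>y. ereal (g y))" "y \<longlonglongrightarrow> z"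
    and m: "ereal m < f z + ereal (g z)"
  shows "\<forall>\<^sub>F n in sequentially. ereal m < f (y n) + ereal (g (y n))"
proof -
  have "ereal (m - g z) < f z"
    using m by (cases "f z") auto
  then obtain k where k: "ereal (m - g z) < ereal k" "ereal k < f z"
    using ereal_dense2 by blast
  have "\<forall>\<^sub>F n in sequentially. ereal k < f (y n)"
    using assms k by (intro lsc_onD_eventually)
  moreover have "\<forall>\<^sub>F n in sequentially. ereal (m - k) < ereal (g (y n))"
    using assms k by (intro lsc_onD_eventually[of "\<lambda>y. ereal (g y)"]) auto
  ultimately show ?thesis
  proof eventually_elim
    case (elim n)
    then show ?case by (cases "f (y n)") auto
  qed
qed

text \<open>A tangent vector to the graph is a limit of pairs consisting of a direction and the
  difference quotient of \<open>F\<close> along it, and each quotient obeys the Lipschitz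
  bound.\<close>

lemma graphical_derivative_norm_le:
  assumes u: "u \<in> graphical_derivative F y v" and y: "y \<in> S" and "open S" and L: "L-lipschitz_on S F"
  shows "norm u \<le> L * norm v"
proof -
  obtain t :: "nat \<Rightarrow> real" and w where t: "\<And>n. t n > 0" "t \<longlonglongrightarrow> 0" and w: "w \<longlonglongrightarrow> (v, u)"
    and gr: "\<And>n. (y, F y) + t n *\<^sub>R w n \<in> {(z, F z) | z. True}"
    using u unfolding graphical_derivative_def tangent_cone_def by auto
  define p q where "p n = fst (w n)" and "q n = snd (w n)" for n
  have p: "p \<longlonglongrightarrow> v" and q: "q \<longlonglongrightarrow> u"
    using tendsto_fst[OF w] tendsto_snd[OF w] by (auto simp: p_def[abs_def] q_def[abs_def])
  have Fq: "F (y + t n *\<^sub>R p n) = F y + t n *\<^sub>R q n" for n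
    using gr[of n] by (cases "w n") (auto simp: p_def q_def)
  have "(\<lambda>n. y + t n *\<^sub>R p n) \<longlonglongrightarrow> y + 0 *\<^sub>R v"
    by (intro tendsto_intros t p)
  then have "\<forall>\<^sub>F n in sequentially. y + t n *\<^sub>R p n \<in> S"
    using \<open>open S\<close> y by (simp add: topological_tendstoD)
  then have "\<forall>\<^sub>F n in sequentially. norm (q n) \<le> L * norm (p n)"
  proof eventually_elim
    case (elim n)
    then have "dist (F (y + t n *\<^sub>R p n)) (F y) \<le> L * dist (y + t n *\<^sub>R p n) y"
      using L y by (intro lipschitz_onD)
    then have "t n * norm (q n) \<le> t n * (L * norm (p n))"
      using t(1)[of n] by (simp add: Fq dist_norm algebra_simps)
    then show ?case using t(1)[of n] by simp
  qed
  then show ?thesis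
    by (intro tendsto_le[OF _ tendsto_mult[OF tendsto_const tendsto_norm[OF p]] tendsto_norm[OF q]]) auto
qed

text \<open>The direction \<open>g t\<close> may vary with \<open>t\<close> because the epigraph
  points constructed below carry corrections of second order in \<open>t\<close>.\<close>

lemma tangent_cone_segmentI:
  fixes d :: "'a::real_normed_vector"
  assumes "\<delta> > 0" and A: "\<And>t. \<lbrakk>0 < t; t < \<delta>\<rbrakk> \<Longrightarrow> a + t *\<^sub>R g t \<in> A" and g: "(g \<longlongrightarrow> d) (at_right 0)"
  shows "d \<in> tangent_cone A a"
proof -
  \<comment> \<open>The summand 2 keeps already \<open>t 0\<close> strictly below
    \<open>\<delta>\<close>.\<close>
  define t where "t n = \<delta> / (real n + 2)" for n
  have "t \<longlonglongrightarrow> 0" unfolding t_def by real_asymp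
  moreover have t: "0 < t n" "t n < \<delta>" for n
    using \<open>\<delta> > 0\<close> by (auto simp: t_def field_simps intro: add_pos_nonneg)
  moreover have "t n \<noteq> 0" for n using t(1)[of n] by simp
  ultimately have "filterlim t (at_right 0) sequentially"
    by (simp add: filterlim_at)
  then have "(\<lambda>n. g (t n)) \<longlonglongrightarrow> d"
    using g filterlim_compose by blast
  then show ?thesis
    using t A \<open>t \<longlonglongrightarrow> 0\<close> unfolding tangent_cone_def by (intro CollectI exI[of _ t]) auto
qed

text \<open>Every inequality below between subgradients and function values is of this half-space form,
  so it only has to be checked for Frechet normals, by exhibiting tangent vectors.\<close>

lemma clarke_normal_cone_halfspace:
  assumes v: "v \<in> clarke_normal_cone A a" and h: "isCont h a" 
    and ev: "\<forall>\<^sub>F a' in nhds a. a' \<in> A \<longrightarrow> (\<forall>n \<in> frechet_normal_cone A a'. inner n (h a') \<le> 0)"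
  shows "inner v (h a) \<le> 0"
proof -
  have "{v. \<exists>a' v'. (\<forall>n::nat. a' n \<in> A \<and> v' n \<in> frechet_normal_cone A (a' n)) \<and>
      (\<lambda>n. (a' n, v' n)) \<longlonglongrightarrow> (a, v)} \<subseteq> {v. inner v (h a) \<le> 0}"
  proof clarify
    fix w a' v' assume *: "\<forall>n::nat. a' n \<in> A \<and> v' n \<in> frechet_normal_cone A (a' n)"
      and lim: "(\<lambda>n. (a' n, v' n)) \<longlonglongrightarrow> (a, w)"
    have a': "a' \<longlonglongrightarrow> a" and v': "v' \<longlonglongrightarrow> w"
      using tendsto_fst[OF lim] tendsto_snd[OF lim] by auto
    have "\<forall>\<^sub>F n in sequentially. inner (v' n) (h (a' n)) \<le> 0"
      using eventually_compose_filterlim[OF ev a'] * by (auto elim: eventually_mono)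
    moreover have "(\<lambda>n. inner (v' n) (h (a' n))) \<longlonglongrightarrow> inner w (h a)"
      using isCont_tendsto_compose[OF h a'] v' by (intro tendsto_inner)
    ultimately show "inner w (h a) \<le> 0"
      by (intro tendsto_upperbound) auto
  qed
  moreover have "closed {v. inner v (h a) \<le> 0}" "convex {v. inner v (h a) \<le> 0}"
    using closed_halfspace_le[of "h a" 0] convex_halfspace_le[of "h a" 0]
    by (simp_all add: inner_commute)
  ultimately have "clarke_normal_cone A a \<subseteq> {v. inner v (h a) \<le> 0}"
    unfolding clarke_normal_cone_def by (intro closure_minimal hull_minimal)
  then show ?thesis using v by auto
qed

section \<open>Subgradient inequalities under weak convexity and weak concavity\<close>

lemma frechet_normal_imp_clarke_normal:
  assumes "v \<in> frechet_normal_cone A a" "a \<in> A"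
  shows "v \<in> clarke_normal_cone A a"
  unfolding clarke_normal_cone_def
  by (intro subsetD[OF closure_subset] hull_inc CollectI exI[of _ "\<lambda>_. a"] exI[of _ "\<lambda>_. v"])
    (use assms in auto)

lemma clarke_subdifferentialD:
  assumes "\<zeta> \<in> clarke_subdifferential f y"
  shows "f y < \<infinity>" "(\<zeta>, -1) \<in> clarke_normal_cone (epi f) (y, real_of_ereal (f y))"
  using assms by (auto simp: clarke_subdifferential_def split: if_splits)

lemma eventually_fst_in_interior:
  "y \<in> interior U \<Longrightarrow> \<forall>\<^sub>F p in nhds (y, c). fst p \<in> interior U"
  using topological_tendstoD[OF tendsto_fst[OF filterlim_ident], of "interior U" "(y, c)"] by simp

text \<open>Moving from an epigraph point towards \<open>(z, \<beta>)\<close> leaves the epigraph by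
  no more than the convexity defect, and raising the slope by that defect gives the tangent vector
  \<open>h p\<close>. Pairing \<open>(\<zeta>, -1)\<close> with it is exactly the claimed
  inequality. The field \<open>h\<close> is set up at every nearby epigraph point, not only on the
  graph, since Clarke normals are limits of normals at such points.\<close>

lemma clarke_subdifferential_weakly_convex:
  fixes f :: "'a::euclidean_space \<Rightarrow> ereal"
  assumes \<zeta>: "\<zeta> \<in> clarke_subdifferential f y" and y: "y \<in> interior U" "f y \<noteq> - \<infinity>"
    and U: "convex U"
    and wc: "\<And>x z u. \<lbrakk>x \<in> U; z \<in> U; u \<in> {0..1}\<rbrakk> \<Longrightarrow> f (u *\<^sub>R x + (1 - u) *\<^sub>R z) \<le>
          ereal u * f x + ereal (1 - u) * f z + ereal (\<sigma> * (u * (1 - u) / 2) * (norm (x - z))\<^sup>2)"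
    and z: "z \<in> U" "f z \<le> ereal \<beta>"
  shows "real_of_ereal (f y) + inner \<zeta> (z - y) - \<sigma> / 2 * (norm (z - y))\<^sup>2 \<le> \<beta>"
proof -
  define h where "h p = (z - fst p, \<beta> - snd p + \<sigma> / 2 * (norm (z - fst p))\<^sup>2)" for p :: "'a \<times> real"
  have fy: "f y < \<infinity>" and N: "(\<zeta>, -1) \<in> clarke_normal_cone (epi f) (y, real_of_ereal (f y))"
    using clarke_subdifferentialD[OF \<zeta>] by auto
  have tan: "h p \<in> tangent_cone (epi f) p" if p: "p \<in> epi f" "fst p \<in> interior U" for p
  proof -
    obtain y' \<alpha> where p': "p = (y', \<alpha>)" by (cases p)
    have y': "y' \<in> U" "f y' \<le> ereal \<alpha>"
      using p interior_subset by (auto simp: p' epi_def)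
    define g where "g t = (z - y', \<beta> - \<alpha> + \<sigma> * (1 - t) / 2 * (norm (z - y'))\<^sup>2)" for t :: real
    have "p + t *\<^sub>R g t \<in> epi f" if t: "0 < t" "t < 1" for t
    proof -
      have "f (t *\<^sub>R z + (1 - t) *\<^sub>R y') \<le> ereal t * f z + ereal (1 - t) * f y' 
          + ereal (\<sigma> * (t * (1 - t) / 2) * (norm (z - y'))\<^sup>2)"
        using t y' z by (intro wc) auto
      also have "\<dots> \<le> ereal t * ereal \<beta> + ereal (1 - t) * ereal \<alpha> 
          + ereal (\<sigma> * (t * (1 - t) / 2) * (norm (z - y'))\<^sup>2)"
        using t y' z by (intro add_mono ereal_mult_left_mono) auto
      finally show ?thesis
        using t by (simp add: p' g_def epi_def algebra_simps)
    qed
    moreover have "(g \<longlongrightarrow> g 0) (at_right 0)"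
      unfolding g_def by (intro tendsto_intros) auto
    moreover have "g 0 = h p" by (simp add: g_def h_def p')
    ultimately show ?thesis
      using tangent_cone_segmentI[of 1 p g "epi f"] by simp
  qed
  have "inner (\<zeta>, -1) (h (y, real_of_ereal (f y))) \<le> 0"
  proof (rule clarke_normal_cone_halfspace[OF N])
    show "isCont h (y, real_of_ereal (f y))"
      unfolding h_def by (intro continuous_intros)
    show "\<forall>\<^sub>F a' in nhds (y, real_of_ereal (f y)). a' \<in> epi f \<longrightarrow>
        (\<forall>n\<in>frechet_normal_cone (epi f) a'. inner n (h a') \<le> 0)"
      using eventually_fst_in_interior[OF y(1)]
      by (rule eventually_mono) (use tan in \<open>auto simp: frechet_normal_cone_def\<close>)
  qed
  then show ?thesis by (simp add: h_def algebra_simps)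
qed

text \<open>The point \<open>y\<close> lies between \<open>z\<close> and the point reached by moving slightly away from \<open>z\<close>;
  semiconvexity of \<open>- g\<close> along this segment makes \<open>y - z\<close> an explicit tangent direction.\<close>

lemma clarke_subdifferential_weakly_concave:
  fixes g :: "'a::euclidean_space \<Rightarrow> real"
  assumes \<zeta>: "\<zeta> \<in> clarke_subdifferential (\<lambda>y. ereal (g y)) y" and y: "y \<in> interior U"
    and wc: "\<And>x z u. \<lbrakk>x \<in> U; z \<in> U; u \<in> {0..1}\<rbrakk> \<Longrightarrow>
          u * g x + (1 - u) * g z \<le> g (u *\<^sub>R x + (1 - u) *\<^sub>R z) + \<sigma> * (u * (1 - u) / 2) * (norm (x - z))\<^sup>2"
    and z: "z \<in> U"
  shows "g z \<le> g y + inner \<zeta> (z - y) + \<sigma> / 2 * (norm (z - y))\<^sup>2"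
proof -
  let ?A = "epi (\<lambda>y. ereal (g y))"
  define h where "h p = (fst p - z, snd p - g z + \<sigma> / 2 * (norm (z - fst p))\<^sup>2)" for p :: "'a \<times> real"
  have N: "(\<zeta>, -1) \<in> clarke_normal_cone ?A (y, g y)"
    using clarke_subdifferentialD[OF \<zeta>] by auto
  have tan: "h p \<in> tangent_cone ?A p" if p: "p \<in> ?A" "fst p \<in> interior U" for p
  proof -
    obtain y' \<alpha> where p': "p = (y', \<alpha>)" by (cases p)
    have y': "y' \<in> U" "g y' \<le> \<alpha>"
      using p interior_subset by (auto simp: p' epi_def)
    define k where "k t = (y' - z, \<alpha> - g z + \<sigma> * (1 + t) / 2 * (norm (z - y'))\<^sup>2)" for t :: real
    have "((\<lambda>t. y' + t *\<^sub>R (y' - z)) \<longlongrightarrow> y' + 0 *\<^sub>R (y' - z)) (at_right 0)"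
      by (intro tendsto_intros)
    then have "\<forall>\<^sub>F t in at_right 0. y' + t *\<^sub>R (y' - z) \<in> interior U"
      using p by (intro topological_tendstoD) (auto simp: p')
    then obtain \<delta> where "\<delta> > 0" and \<delta>: "\<And>t. \<lbrakk>0 < t; t < \<delta>\<rbrakk> \<Longrightarrow> y' + t *\<^sub>R (y' - z) \<in> U"
      unfolding eventually_at_right_field using interior_subset by (metis subsetD)
    have "p + t *\<^sub>R k t \<in> ?A" if t: "0 < t" "t < \<delta>" for t
    proof -
      define x where "x = y' + t *\<^sub>R (y' - z)"
      \<comment> \<open>This weight places \<open>y'\<close> on the segment from \<open>x\<close> to
        \<open>z\<close>; multiplying the inequality by \<open>1 + t\<close> then isolates
        \<open>g x\<close>, the value at the point beyond \<open>y'\<close>.\<close>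
      define u where "u = 1 / (1 + t)"
      have u: "u \<in> {0..1}" "1 - u = t * u" "(1 + t) * u = 1"
        using t by (auto simp: u_def field_simps)
      have comb: "u *\<^sub>R x + (1 - u) *\<^sub>R z = y'"
      proof -
        have "u *\<^sub>R x + (1 - u) *\<^sub>R z = ((1 + t) * u) *\<^sub>R y'"
          unfolding u(2) x_def by (simp add: algebra_simps)
        then show ?thesis using u(3) by simp
      qed
      have "x - z = (1 + t) *\<^sub>R (y' - z)"
        by (simp add: x_def algebra_simps)
      then have nxz: "(norm (x - z))\<^sup>2 = (1 + t)\<^sup>2 * (norm (z - y'))\<^sup>2"
        using t by (simp add: power_mult_distrib norm_minus_commute)
      have "x \<in> U" unfolding x_def by (rule \<delta>[OF t])
      then have "u * g x + (t * u) * g z \<le> g y' + \<sigma> * (u * (t * u) / 2) * ((1 + t)\<^sup>2 * (norm (z - y'))\<^sup>2)"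
        using wc[OF _ z u(1), of x] unfolding comb nxz unfolding u(2) by simp
      then have "(1 + t) * (u * g x + (t * u) * g z)
        \<le> (1 + t) * (g y' + \<sigma> * (u * (t * u) / 2) * ((1 + t)\<^sup>2 * (norm (z - y'))\<^sup>2))"
        using t by (intro mult_left_mono) auto
      also have "\<dots> = (1 + t) * g y' + ((1 + t) * u) * ((1 + t) * u) * (\<sigma> * t / 2) * ((1 + t) * (norm (z - y'))\<^sup>2)"
        by (simp add: power2_eq_square field_simps)
      also have "(1 + t) * (u * g x + (t * u) * g z) = ((1 + t) * u) * (g x + t * g z)"
        by (simp add: algebra_simps)
      finally have "g x \<le> (1 + t) * g y' - t * g z + \<sigma> * t / 2 * ((1 + t) * (norm (z - y'))\<^sup>2)"
        unfolding u(3) by simp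
      also have "\<dots> \<le> (1 + t) * \<alpha> - t * g z + \<sigma> * t / 2 * ((1 + t) * (norm (z - y'))\<^sup>2)"
        using t y'(2) by (simp add: mult_left_mono)
      finally show ?thesis
        by (simp add: p' k_def epi_def x_def algebra_simps add_divide_distrib)
    qed
    moreover have "(k \<longlongrightarrow> k 0) (at_right 0)"
      unfolding k_def by (intro tendsto_intros) auto
    moreover have "k 0 = h p" by (simp add: k_def h_def p')
    ultimately show ?thesis
      using tangent_cone_segmentI[of \<delta> p k ?A] \<open>\<delta> > 0\<close> by simp
  qed
  have "inner (\<zeta>, -1) (h (y, g y)) \<le> 0"
  proof (rule clarke_normal_cone_halfspace[OF N])
    show "isCont h (y, g y)"
      unfolding h_def by (intro continuous_intros)
    show "\<forall>\<^sub>F a' in nhds (y, g y). a' \<in> ?A \<longrightarrow>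
        (\<forall>n\<in>frechet_normal_cone ?A a'. inner n (h a') \<le> 0)"
      using eventually_fst_in_interior[OF y]
      by (rule eventually_mono) (use tan in \<open>auto simp: frechet_normal_cone_def\<close>)
  qed
  then show ?thesis by (simp add: h_def inner_diff_right)
qed

text \<open>Along a tangent sequence the quadratic term is of second order in the step
  \<open>t n\<close>, so it disappears after division by \<open>t n\<close>. Thus
  \<open>(\<zeta>, -1)\<close> is already a Frechet normal.\<close>

lemma proximal_subgradient_imp_clarke:
  fixes f :: "'a::euclidean_space \<Rightarrow> ereal"
  assumes fy: "f y = ereal c" and y: "y \<in> interior U"
    and prox: "\<And>z \<beta>. z \<in> U \<Longrightarrow> f z \<le> ereal \<beta> \<Longrightarrow> c + inner \<zeta> (z - y) - \<sigma> * (norm (z - y))\<^sup>2 \<le> \<beta>"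
  shows "\<zeta> \<in> clarke_subdifferential f y"
proof -
  have "inner (\<zeta>, -1) w \<le> 0" if w: "w \<in> tangent_cone (epi f) (y, c)" for w
  proof -
    obtain t :: "nat \<Rightarrow> real" and w' where t: "\<And>n. t n > 0" "t \<longlonglongrightarrow> 0" and w': "w' \<longlonglongrightarrow> w"
      and ep: "\<And>n. (y, c) + t n *\<^sub>R w' n \<in> epi f"
      using w unfolding tangent_cone_def by auto
    define p q where "p n = fst (w' n)" and "q n = snd (w' n)" for n
    have p: "p \<longlonglongrightarrow> fst w" and q: "q \<longlonglongrightarrow> snd w"
      using tendsto_fst[OF w'] tendsto_snd[OF w'] by (auto simp: p_def[abs_def] q_def[abs_def])
    have fq: "f (y + t n *\<^sub>R p n) \<le> ereal (c + t n * q n)" for n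
      using ep[of n] by (cases "w' n") (auto simp: p_def q_def epi_def)
    have "(\<lambda>n. y + t n *\<^sub>R p n) \<longlonglongrightarrow> y + 0 *\<^sub>R fst w"
      by (intro tendsto_intros t p)
    then have "\<forall>\<^sub>F n in sequentially. y + t n *\<^sub>R p n \<in> interior U"
      using y by (simp add: topological_tendstoD)
    then have "\<forall>\<^sub>F n in sequentially. inner \<zeta> (p n) - \<sigma> * t n * (norm (p n))\<^sup>2 \<le> q n"
    proof eventually_elim
      case (elim n)
      then have "y + t n *\<^sub>R p n \<in> U" using interior_subset by blast
      from prox[OF this fq] have "t n * (inner \<zeta> (p n) - \<sigma> * t n * (norm (p n))\<^sup>2) \<le> t n * q n"
        by (simp add: power2_eq_square algebra_simps)
      then show ?case using t(1)[of n] by simp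
    qed
    moreover have "(\<lambda>n. inner \<zeta> (p n) - \<sigma> * t n * (norm (p n))\<^sup>2) \<longlonglongrightarrow> inner \<zeta> (fst w) - \<sigma> * 0 * (norm (fst w))\<^sup>2"
      by (intro tendsto_intros p t)
    ultimately have "inner \<zeta> (fst w) - \<sigma> * 0 * (norm (fst w))\<^sup>2 \<le> snd w"
      using q by (intro tendsto_le[of sequentially q _ "\<lambda>n. inner \<zeta> (p n) - \<sigma> * t n * (norm (p n))\<^sup>2"]) auto
    then show ?thesis by (cases w) auto
  qed
  then have "(\<zeta>, -1) \<in> clarke_normal_cone (epi f) (y, c)"
    by (intro frechet_normal_imp_clarke_normal) (auto simp: frechet_normal_cone_def epi_def fy)
  then show ?thesis by (simp add: clarke_subdifferential_def fy)
qed

text \<open>In cases (i) and (ii) one summand of the energy vanishes; by this lemma so does its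
  selection, and the other selection is a subgradient of the whole energy.\<close>

lemma clarke_subdifferential_zero: "clarke_subdifferential (\<lambda>_::'a::euclidean_space. 0) y = {0}"
proof -
  have "\<zeta> = 0" if "\<zeta> \<in> clarke_subdifferential (\<lambda>_. 0) y" for \<zeta> :: 'a
  proof -
    have "inner \<zeta> ((y + \<zeta>) - y) \<le> 0"
      using clarke_subdifferential_weakly_convex[OF that, of UNIV 0 "y + \<zeta>" 0] by simp
    then show ?thesis by (metis add_diff_cancel_left' inner_gt_zero_iff not_less)
  qed
  moreover have "0 \<in> clarke_subdifferential (\<lambda>_. 0) y"
    by (rule proximal_subgradient_imp_clarke[of _ _ 0 UNIV _ 0]) (auto simp: zero_ereal_def)
  ultimately show ?thesis by blast
qed

text \<open>The subgradient inequality is stable under limits and, being a proximal inequality,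
  characterises the limit as a Clarke subgradient. The values \<open>f (Y n)\<close> need not
  converge to \<open>f y\<close>; lower semicontinuity lets any \<open>m\<close> below
  \<open>f y\<close> stand in for them, and \<open>m\<close> is raised to \<open>f y\<close> at the
  end.\<close>

lemma clarke_subdifferential_closed_weakly_convex:
  fixes f :: "'a::euclidean_space \<Rightarrow> ereal"
  assumes lsc: "lsc_on UNIV f" and fin: "\<And>x. f x \<noteq> - \<infinity>" and U: "convex U"
    and wc: "\<And>x z u. \<lbrakk>x \<in> U; z \<in> U; u \<in> {0..1}\<rbrakk> \<Longrightarrow> f (u *\<^sub>R x + (1 - u) *\<^sub>R z) \<le>
          ereal u * f x + ereal (1 - u) * f z + ereal (\<sigma> * (u * (1 - u) / 2) * (norm (x - z))\<^sup>2)"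
    and p: "p \<in> U" "f p < \<infinity>" and y: "y \<in> interior U"
    and Y: "Y \<longlonglongrightarrow> y" "Z \<longlonglongrightarrow> \<zeta>" "\<And>n. Z n \<in> clarke_subdifferential f (Y n)"
  shows "\<zeta> \<in> clarke_subdifferential f y"
proof -
  have key: "m + inner \<zeta> (z - y) - \<sigma> / 2 * (norm (z - y))\<^sup>2 \<le> \<beta>"
    if z: "z \<in> U" "f z \<le> ereal \<beta>" and m: "ereal m < f y" for m z \<beta>
  proof -
    have "\<forall>\<^sub>F n in sequentially. ereal m < f (Y n)"
      by (rule lsc_onD_eventually[OF lsc Y(1) m])
    moreover have "\<forall>\<^sub>F n in sequentially. Y n \<in> interior U"
      using Y(1) y by (simp add: topological_tendstoD)
    ultimately have "\<forall>\<^sub>F n in sequentially. m + inner (Z n) (z - Y n) - \<sigma> / 2 * (norm (z - Y n))\<^sup>2 \<le> \<beta>"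
    proof eventually_elim
      case (elim n)
      have "m \<le> real_of_ereal (f (Y n))"
        using elim(1) clarke_subdifferentialD(1)[OF Y(3)[of n]] by (cases "f (Y n)") auto
      then show ?case
        using clarke_subdifferential_weakly_convex[OF Y(3) elim(2) fin U wc z] by linarith
    qed
    moreover have "(\<lambda>n. m + inner (Z n) (z - Y n) - \<sigma> / 2 * (norm (z - Y n))\<^sup>2)
        \<longlonglongrightarrow> m + inner \<zeta> (z - y) - \<sigma> / 2 * (norm (z - y))\<^sup>2"
      by (intro tendsto_intros Y)
    ultimately show ?thesis
      by (intro tendsto_upperbound) auto
  qed
  obtain \<beta> where \<beta>: "f p \<le> ereal \<beta>" using p(2) fin[of p] by (cases "f p") auto
  \<comment> \<open>If \<open>f y\<close> were infinite, every real \<open>m\<close> would be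
    admissible; this one violates the inequality at \<open>p\<close> by exactly 1.\<close>
  have "f y \<noteq> \<infinity>"
    using key[OF p(1) \<beta>, of "\<beta> + 1 - inner \<zeta> (p - y) + \<sigma> / 2 * (norm (p - y))\<^sup>2"] by auto
  then obtain c where c: "f y = ereal c" using fin[of y] by (cases "f y") auto
  show ?thesis
  proof (rule proximal_subgradient_imp_clarke[where f = f and U = U and c = c and \<sigma> = "\<sigma> / 2", OF c y])
    fix z \<beta> assume z: "z \<in> U" "f z \<le> ereal \<beta>"
    show "c + inner \<zeta> (z - y) - \<sigma> / 2 * (norm (z - y))\<^sup>2 \<le> \<beta>"
    proof (rule field_le_epsilon)
      fix e :: real assume "e > 0"
      then show "c + inner \<zeta> (z - y) - \<sigma> / 2 * (norm (z - y))\<^sup>2 \<le> \<beta> + e"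
        using key[OF z, of "c - e"] c by simp
    qed
  qed
qed

section \<open>Normals to epigraphs of Lipschitz functions and closedness\<close>

lemma frechet_normal_cone_scaleR:
  "v \<in> frechet_normal_cone A a \<Longrightarrow> c \<ge> 0 \<Longrightarrow> c *\<^sub>R v \<in> frechet_normal_cone A a"
  by (auto simp: frechet_normal_cone_def mult_nonneg_nonpos)

text \<open>The test direction is \<open>\<xi>\<close> itself, which with slope
  \<open>L * norm \<xi>\<close> is tangent to the epigraph. Consequently a nonzero normal is never
  horizontal and can be scaled to last component \<open>-1\<close> with bounded first
  component.\<close>

lemma frechet_normal_epi_lipschitz:
  fixes g :: "'a::euclidean_space \<Rightarrow> real"
  assumes L: "L-lipschitz_on S g" and S: "open S" "y \<in> S"
    and N: "(\<xi>, \<mu>) \<in> frechet_normal_cone (epi (\<lambda>y. ereal (g y))) (y, \<alpha>)" and \<alpha>: "g y \<le> \<alpha>"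
  shows "norm \<xi> \<le> L * (- \<mu>)"
proof (cases "\<xi> = 0")
  case True
  have "(0, 1) \<in> tangent_cone (epi (\<lambda>y. ereal (g y))) (y, \<alpha>)"
    using \<alpha> by (intro tangent_cone_segmentI[of 1 _ "\<lambda>_. (0, 1)"]) (auto simp: epi_def)
  then have "\<mu> \<le> 0" using N True by (fastforce simp: frechet_normal_cone_def)
  then show ?thesis using True lipschitz_on_nonneg[OF L] by (simp add: mult_nonneg_nonpos)
next
  case False
  have "((\<lambda>t. y + t *\<^sub>R \<xi>) \<longlongrightarrow> y + 0 *\<^sub>R \<xi>) (at_right 0)"
    by (intro tendsto_intros)
  then have "\<forall>\<^sub>F t in at_right 0. y + t *\<^sub>R \<xi> \<in> S"
    using S by (intro topological_tendstoD) auto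
  then obtain \<delta> where "\<delta> > 0" and \<delta>: "\<And>t. \<lbrakk>0 < t; t < \<delta>\<rbrakk> \<Longrightarrow> y + t *\<^sub>R \<xi> \<in> S"
    unfolding eventually_at_right_field by auto
  have "(\<xi>, L * norm \<xi>) \<in> tangent_cone (epi (\<lambda>y. ereal (g y))) (y, \<alpha>)"
  proof (rule tangent_cone_segmentI[OF \<open>\<delta> > 0\<close>])
    fix t assume t: "0 < t" "t < \<delta>"
    have "g (y + t *\<^sub>R \<xi>) \<le> g y + L * (t * norm \<xi>)"
      using lipschitz_onD[OF L \<delta>[OF t] S(2)] t by (simp add: dist_norm)
    then show "(y, \<alpha>) + t *\<^sub>R (\<xi>, L * norm \<xi>) \<in> epi (\<lambda>y. ereal (g y))"
      using \<alpha> by (simp add: epi_def algebra_simps)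
  qed auto
  then have "norm \<xi> * norm \<xi> \<le> norm \<xi> * (L * (- \<mu>))"
    using N by (auto simp: frechet_normal_cone_def dot_square_norm power2_eq_square algebra_simps)
  then show ?thesis using False by (metis mult_left_le_imp_le zero_less_norm_iff)
qed

text \<open>A point outside the closed convex cone of normals at \<open>y\<close> is separated from it; Lipschitz
  continuity makes the normalised Frechet normals near \<open>y\<close> relatively compact, so the
  separation persists for all nearby base points.\<close>

lemma clarke_subdifferential_closed_lipschitz:
  fixes g :: "'a::euclidean_space \<Rightarrow> real"
  assumes L: "L-lipschitz_on S g" and S: "open S" "y \<in> S"
    and Y: "Y \<longlonglongrightarrow> y" "Z \<longlonglongrightarrow> \<zeta>" "\<And>n. Z n \<in> clarke_subdifferential (\<lambda>y. ereal (g y)) (Y n)"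
  shows "\<zeta> \<in> clarke_subdifferential (\<lambda>y. ereal (g y)) y"
proof (rule ccontr)
  define A where "A = epi (\<lambda>y. ereal (g y))"
  define C where "C = clarke_normal_cone A (y, g y)"
  define V where "V = {v. \<exists>a' v'. (\<forall>n::nat. a' n \<in> A \<and> v' n \<in> frechet_normal_cone A (a' n)) \<and>
      (\<lambda>n. (a' n, v' n)) \<longlonglongrightarrow> ((y, g y), v)}"
  have C_V: "C = closure (convex hull V)" by (simp add: C_def V_def clarke_normal_cone_def)
  assume "\<zeta> \<notin> clarke_subdifferential (\<lambda>y. ereal (g y)) y"
  then have "(\<zeta>, -1) \<notin> C" by (simp add: clarke_subdifferential_def C_def A_def)
  moreover have "convex C" "closed C"
    unfolding C_V by (intro convex_closure convex_convex_hull) simp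
  ultimately obtain a b where ab: "inner a (\<zeta>, -1) < b" "\<And>v. v \<in> C \<Longrightarrow> b < inner a v"
    using separating_hyperplane_closed_point[of C "(\<zeta>, -1)"] by metis
  have limC: "v \<in> C" if "v \<in> V" for v
    unfolding C_V using that by (intro subsetD[OF closure_subset] hull_inc)
  have "0 \<in> C"
    unfolding C_def
    by (rule frechet_normal_imp_clarke_normal) (auto simp: frechet_normal_cone_def epi_def A_def)
  then have "b < 0" using ab(2)[of 0] by simp
  have lim_nonneg: "0 \<le> inner a v" if v: "v \<in> V" for v
  proof (rule ccontr)
    assume neg: "\<not> 0 \<le> inner a v"
    \<comment> \<open>This factor puts \<open>c *\<^sub>R v\<close> on the separating hyperplane,
      which \<open>C\<close> does not meet; as \<open>V\<close> is a cone, that is a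
      contradiction.\<close>
    define c where "c = b / inner a v"
    have "c > 0" using neg \<open>b < 0\<close> by (simp add: c_def divide_neg_neg)
    obtain a' v' where *: "\<forall>n::nat. a' n \<in> A \<and> v' n \<in> frechet_normal_cone A (a' n)"
      "(\<lambda>n. (a' n, v' n)) \<longlonglongrightarrow> ((y, g y), v)"
      using v unfolding V_def by blast
    then have "(\<lambda>n. (a' n, c *\<^sub>R v' n)) \<longlonglongrightarrow> ((y, g y), c *\<^sub>R v)"
      using tendsto_fst[OF *(2)] tendsto_snd[OF *(2)] by (auto intro!: tendsto_intros)
    then have "c *\<^sub>R v \<in> V"
      unfolding V_def using * \<open>c > 0\<close>
      by (intro CollectI exI[of _ a'] exI[of _ "\<lambda>n. c *\<^sub>R v' n"]) (auto intro: frechet_normal_cone_scaleR)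
    from ab(2)[OF limC[OF this]] show False using neg by (simp add: c_def)
  qed
  \<comment> \<open>The tilt by \<open>b / 2\<close> leaves a margin on vectors with last component
    \<open>-1\<close>: since \<open>b < 0\<close>, pairing with \<open>h\<close> is at most
    \<open>b / 2 < 0\<close> for limiting normals, but exceeds \<open>- b / 2 > 0\<close> at
    \<open>(\<zeta>, -1)\<close>.\<close>
  define h where "h = (- fst a, - snd a - b / 2)"
  have h: "inner v h = - inner a v - b / 2 * snd v" for v
    by (cases a; cases v) (simp add: h_def inner_commute algebra_simps)
  have "\<forall>\<^sub>F q in nhds (y, g y). q \<in> A \<longrightarrow> (\<forall>n\<in>frechet_normal_cone A q. inner n h \<le> 0)"
  proof (rule ccontr)
    assume neg: "\<not> ?thesis"
    have "\<exists>q n. dist q (y, g y) < 1 / Suc k \<and> q \<in> A \<and> fst q \<in> S \<and> n \<in> frechet_normal_cone A q \<and> inner n h > 0" for k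
    proof -
      have "\<forall>\<^sub>F q in nhds (y, g y). dist q (y, g y) < 1 / Suc k"
        unfolding eventually_nhds_metric by (intro exI[of _ "1 / Suc k"]) auto
      moreover have "\<forall>\<^sub>F q in nhds (y, g y). fst q \<in> S"
        using eventually_fst_in_interior[of y S "g y"] S by (simp add: interior_open)
      ultimately have "\<forall>\<^sub>F q in nhds (y, g y). dist q (y, g y) < 1 / Suc k \<and> fst q \<in> S"
        by eventually_elim auto
      then show ?thesis
        using frequently_eventually_frequently[OF neg[unfolded not_eventually]]
        by (force dest!: frequently_ex simp: not_le)
    qed
    then obtain q n where q: "\<And>k. dist (q k) (y, g y) < 1 / Suc k" "\<And>k. q k \<in> A" "\<And>k. fst (q k) \<in> S"
      and n: "\<And>k. n k \<in> frechet_normal_cone A (q k)" "\<And>k. inner (n k) h > 0"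
      by metis
    have nb: "norm (fst (n k)) \<le> L * (- snd (n k))" for k
      using frechet_normal_epi_lipschitz[OF L S(1) q(3), of "fst (n k)" "snd (n k)" k "snd (q k)"]
        n(1)[of k] q(2)[of k] by (auto simp: A_def epi_def split: prod.splits)
    have neg_snd: "snd (n k) < 0" for k
    proof -
      have "snd (n k) \<le> 0"
      proof -
        have "(0, 1) \<in> tangent_cone A (q k)"
          using q(2)[of k] unfolding A_def by (cases "q k", intro tangent_cone_segmentI[of 1 _ "\<lambda>_. (0, 1)"]) (auto simp: epi_def)
        then show ?thesis using n(1)[of k] by (cases "n k") (fastforce simp: frechet_normal_cone_def)
      qed
      moreover have "snd (n k) \<noteq> 0"
        using nb[of k] n(2)[of k] by (cases "n k") (auto simp flip: zero_prod_def)
      ultimately show ?thesis by simp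
    qed
    define m where "m k = (1 / (- snd (n k))) *\<^sub>R n k" for k
    have m: "m k \<in> frechet_normal_cone A (q k)" "inner (m k) h > 0" "snd (m k) = -1" "norm (fst (m k)) \<le> L" for k
    proof -
      have c: "1 / (- snd (n k)) > 0" using neg_snd[of k] by simp
      show "m k \<in> frechet_normal_cone A (q k)"
        unfolding m_def using n(1) c by (intro frechet_normal_cone_scaleR) auto
      show "inner (m k) h > 0"
        unfolding m_def inner_scaleR_left using c n(2) by (rule mult_pos_pos)
      show "snd (m k) = -1"
        unfolding m_def using neg_snd[of k] by simp
      have "norm (fst (m k)) = 1 / (- snd (n k)) * norm (fst (n k))"
        unfolding m_def fst_scaleR norm_scaleR using c by simp
      also have "\<dots> \<le> 1 / (- snd (n k)) * (L * (- snd (n k)))"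
        using nb c by (intro mult_left_mono) auto
      also have "\<dots> = L" using neg_snd[of k] by simp
      finally show "norm (fst (m k)) \<le> L" .
    qed
    have "bounded (range m)"
    proof (rule boundedI)
      fix v assume "v \<in> range m"
      then obtain k where "v = m k" by auto
      then show "norm v \<le> L + 1"
        using m(3,4)[of k] norm_Pair_le[of "fst v" "snd v"] unfolding prod.collapse by simp
    qed
    then obtain l r where r: "strict_mono r" "(m \<circ> r) \<longlonglongrightarrow> l"
      using bounded_imp_convergent_subsequence by blast
    have "q \<longlonglongrightarrow> (y, g y)"
      using q(1) by (intro metric_tendsto_imp_tendsto[OF LIMSEQ_Suc[OF lim_inverse_n'], of _ _ ] always_eventually)
        (auto intro: less_imp_le)
    then have "(q \<circ> r) \<longlonglongrightarrow> (y, g y)" using r(1) LIMSEQ_subseq_LIMSEQ by blast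
    then have "(\<lambda>k. ((q \<circ> r) k, (m \<circ> r) k)) \<longlonglongrightarrow> ((y, g y), l)"
      using r(2) by (rule tendsto_Pair)
    then have "l \<in> V"
      unfolding V_def using m(1) q(2) by (intro CollectI exI[of _ "q \<circ> r"] exI[of _ "m \<circ> r"]) auto
    then have "0 \<le> inner a l" by (rule lim_nonneg)
    moreover have "inner l h \<ge> 0"
      using m(2) by (intro tendsto_lowerbound[OF tendsto_inner[OF r(2) tendsto_const]] always_eventually)
        (auto intro: less_imp_le)
    moreover have "snd l = -1"
      using tendsto_snd[OF r(2)] m(3) by (simp add: LIMSEQ_const_iff)
    ultimately show False using h[of l] \<open>b < 0\<close> by simp
  qed
  \<comment> \<open>The half-space criterion will be applied at the points
    \<open>(Y k, g (Y k))\<close>, so the bound is needed on a neighbourhood of each of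
    them.\<close>
  then have "\<forall>\<^sub>F p in nhds (y, g y). \<forall>\<^sub>F q in nhds p. q \<in> A \<longrightarrow> (\<forall>n\<in>frechet_normal_cone A q. inner n h \<le> 0)"
    by (simp add: eventually_eventually)
  moreover have "isCont g y"
    using lipschitz_on_continuous_on[OF L] S by (meson continuous_on_eq_continuous_at)
  then have "(\<lambda>k. (Y k, g (Y k))) \<longlonglongrightarrow> (y, g y)"
    by (intro tendsto_Pair Y(1) isCont_tendsto_compose[of _ g])
  ultimately have "\<forall>\<^sub>F k in sequentially. \<forall>\<^sub>F q in nhds (Y k, g (Y k)). q \<in> A \<longrightarrow> (\<forall>n\<in>frechet_normal_cone A q. inner n h \<le> 0)"
    by (rule eventually_compose_filterlim)
  then have "\<forall>\<^sub>F k in sequentially. inner (Z k, -1) h \<le> 0"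
  proof eventually_elim
    case (elim k)
    have "(Z k, -1) \<in> clarke_normal_cone A (Y k, g (Y k))"
      using clarke_subdifferentialD(2)[OF Y(3)] by (simp add: A_def)
    from clarke_normal_cone_halfspace[OF this, of "\<lambda>_. h"] elim show ?case by simp
  qed
  moreover have "(\<lambda>k. inner (Z k, -1) h) \<longlonglongrightarrow> inner (\<zeta>, -1) h"
    by (intro tendsto_intros Y)
  ultimately have "inner (\<zeta>, -1) h \<le> 0"
    by (intro tendsto_upperbound) auto
  then show False using ab(1) \<open>b < 0\<close> unfolding h by simp
qed

text \<open>The sublevel sets in time are closed: almost minimal elements at converging times are
  bounded, and a limit of a subsequence belongs to \<open>G\<close> at the limit point. The excess
  \<open>1 / Suc n\<close> allows for an infimum that is not known to be attained.\<close>

lemma set_edist_measurable_along_curve: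
  fixes G :: "'a::metric_space \<Rightarrow> 'b::euclidean_space set" and x :: "real \<Rightarrow> 'a"
  assumes cont: "continuous_on {\<tau>..} x" and B: "\<And>t. t \<ge> \<tau> \<Longrightarrow> x t \<in> B"
    and closed: "\<And>Y y Z \<zeta>. \<lbrakk>y \<in> B; Y \<longlonglongrightarrow> y; Z \<longlonglongrightarrow> \<zeta>; \<And>n. Z n \<in> G (Y n)\<rbrakk> \<Longrightarrow> \<zeta> \<in> G y"
  shows "(\<lambda>s. set_edist 0 (G (x s))) \<in> borel_measurable (lebesgue_on {\<tau>..})"
proof (rule borel_measurableI_le)
  fix c :: ennreal
  let ?E = "{s \<in> {\<tau>..}. set_edist 0 (G (x s)) \<le> c}"
  have "closed ?E"
  proof (cases "c = top")
    case True
    then show ?thesis using closed_atLeast[of \<tau>] by (simp add: atLeast_def)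
  next
    case False
    then obtain c' where c': "c = ennreal c'" "c' \<ge> 0" by (cases c) auto
    show ?thesis
      unfolding closed_sequential_limits
    proof (intro allI impI, elim conjE)
      fix T s assume T: "\<forall>n. T n \<in> ?E" and lim: "T \<longlonglongrightarrow> s"
      have s: "s \<ge> \<tau>" using T lim by (intro LIMSEQ_le_const[OF lim]) auto
      have xT: "(\<lambda>n. x (T n)) \<longlonglongrightarrow> x s"
        using continuous_on_tendsto_compose[OF cont lim] s T by simp
      have "\<exists>\<zeta>. \<zeta> \<in> G (x (T n)) \<and> norm \<zeta> < c' + 1 / Suc n" for n
      proof -
        have "set_edist 0 (G (x (T n))) \<le> c" using T by blast
        also have "\<dots> < ennreal (c' + 1 / Suc n)"
          unfolding c'(1) using c'(2) by (simp add: ennreal_less_iff)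
        finally obtain \<zeta> where "\<zeta> \<in> G (x (T n))" "ennreal (dist 0 \<zeta>) < ennreal (c' + 1 / Suc n)"
          unfolding set_edist_def INF_less_iff by blast
        then show ?thesis by (auto simp: ennreal_less_iff)
      qed
      then obtain Z where Z: "\<And>n. Z n \<in> G (x (T n))" "\<And>n. norm (Z n) < c' + 1 / Suc n"
        by metis
      have "bounded (range Z)"
      proof (rule boundedI)
        fix v assume "v \<in> range Z"
        then obtain n where v: "v = Z n" by auto
        have "1 / real (Suc n) \<le> 1" by simp
        then show "norm v \<le> c' + 1" unfolding v using Z(2)[of n] by linarith
      qed
      then obtain l r where r: "strict_mono r" "(Z \<circ> r) \<longlonglongrightarrow> l"
        using bounded_imp_convergent_subsequence by blast
      have "l \<in> G (x s)"
        using Z(1) s LIMSEQ_subseq_LIMSEQ[OF xT r(1)] r(2)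
        by (intro closed[of "x s" "(\<lambda>n. x (T n)) \<circ> r" "Z \<circ> r"]) (auto intro: B)
      moreover have "norm l \<le> c'"
      proof (rule tendsto_le[OF _ _ tendsto_norm[OF r(2)]])
        have "(\<lambda>n. c' + 1 / real (Suc n)) \<longlonglongrightarrow> c' + 0"
          by (intro tendsto_intros LIMSEQ_Suc[OF lim_inverse_n'])
        from LIMSEQ_subseq_LIMSEQ[OF this r(1)]
        show "((\<lambda>n. c' + 1 / real (Suc n)) \<circ> r) \<longlonglongrightarrow> c'" by simp
        show "\<forall>\<^sub>F n in sequentially. norm ((Z \<circ> r) n) \<le> ((\<lambda>n. c' + 1 / real (Suc n)) \<circ> r) n"
          using Z(2) by (auto intro!: always_eventually less_imp_le)
      qed simp
      ultimately have "set_edist 0 (G (x s)) \<le> c"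
        unfolding set_edist_def c' by (intro INF_lower2[of l]) (auto intro: ennreal_leI)
      then show "s \<in> ?E" using s by simp
    qed
  qed
  then show "{s \<in> space (lebesgue_on {\<tau>..}). set_edist 0 (G (x s)) \<le> c} \<in> sets (lebesgue_on {\<tau>..})"
    by (auto simp: sets_restrict_space_iff borel_closed)
qed

section \<open>Curves dissipating energy\<close>

lemma locally_lipschitz_on_obtains:
  assumes "locally_lipschitz_on \<Omega> f" "open \<Omega>" "p \<in> \<Omega>"
  obtains S L where "open S" "p \<in> S" "L-lipschitz_on S f"
proof -
  obtain \<epsilon> L where "\<epsilon> > 0" "L-lipschitz_on (ball p \<epsilon> \<inter> \<Omega>) f"
    using assms unfolding locally_lipschitz_on_def by blast
  then show ?thesis
    using assms by (intro that[of "ball p \<epsilon> \<inter> \<Omega>" L]) auto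
qed

lemma set_edist_0_le: "u \<in> G \<Longrightarrow> set_edist 0 G \<le> ennreal (norm u)"
  unfolding set_edist_def by (rule INF_lower2) auto

lemma compact_sublevel:
  fixes f g :: "real \<Rightarrow> real"
  assumes "continuous_on {u..v} f" "continuous_on {u..v} g"
  shows "compact {s \<in> {u..v}. f s \<le> g s}"
proof -
  have "bounded {s \<in> {u..v}. f s \<le> g s}"
    by (rule bounded_subset[OF bounded_closed_interval[of u v]]) auto
  then show ?thesis
    using continuous_on_closed_Collect_le[OF assms closed_atLeastAtMost]
    by (simp only: compact_eq_bounded_closed)
qed

text \<open>\<open>e\<close> is the energy along the curve and \<open>e\<^sub>0\<close> the energy of a limit point.\<close>

locale dissipative_curve =
  fixes x :: "real \<Rightarrow> 'a::euclidean_space" and e :: "real \<Rightarrow> real" and e\<^sub>0 \<rho> :: real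
  assumes ac: "\<And>a b. 0 \<le> a \<Longrightarrow> a \<le> b \<Longrightarrow> absolutely_continuous_on_interval a b x"
    and diff: "AE t in lebesgue. t \<ge> 0 \<longrightarrow> x differentiable (at t)"
    and sq_int: "\<And>a b. 0 \<le> a \<Longrightarrow> a \<le> b \<Longrightarrow>
      integrable (lebesgue_on {a..b}) (\<lambda>r. (norm (vector_derivative x (at r)))\<^sup>2)"
    and diss: "\<And>a b. 0 \<le> a \<Longrightarrow> a \<le> b \<Longrightarrow>
      \<rho> * (LINT r|lebesgue_on {a..b}. (norm (vector_derivative x (at r)))\<^sup>2) \<le> e a - e b"
    and lower: "\<And>t. 0 \<le> t \<Longrightarrow> e\<^sub>0 \<le> e t"
    and rho: "\<rho> > 0"
begin

section \<open>Displacement, action and energy\<close>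

abbreviation "speed t \<equiv> norm (vector_derivative x (at t))"
abbreviation "action a b \<equiv> (LINT r|lebesgue_on {a..b}. (speed r)\<^sup>2)"

lemma action_nonneg: "0 \<le> action a b"
  by (rule integral_nonneg_AE) simp

lemma action_le: "0 \<le> a \<Longrightarrow> a \<le> b \<Longrightarrow> action a b \<le> (e a - e b) / \<rho>"
  using diss[of a b] rho by (simp add: field_simps)

lemma energy_mono: "0 \<le> a \<Longrightarrow> a \<le> b \<Longrightarrow> e b \<le> e a"
  using diss[of a b] rho action_nonneg[of a b] mult_nonneg_nonneg[of \<rho> "action a b"] by linarith

lemma continuous_curve: "continuous_on {0..} x"
  unfolding continuous_on_eq_continuous_within
proof
  fix t :: real assume "t \<in> {0..}"
  then have "continuous (at t within {0..t + 1}) x"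
    using absolutely_continuous_on_interval_imp_continuous_on[OF ac[of 0 "t + 1"]]
    by (auto simp: continuous_on_eq_continuous_within)
  moreover have "at t within {0..t + 1} = at t within {0..}"
    by (rule at_within_nhd[of _ "{..<t + 1}"]) auto
  ultimately show "continuous (at t within {0..}) x" by simp
qed

lemma has_integral_action:
  assumes "0 \<le> a" "a \<le> b"
  shows "((\<lambda>r. (speed r)\<^sup>2) has_integral action a b) {a..b}"
  using has_integral_integral_lebesgue_on[OF sq_int[OF assms]] by simp

text \<open>Only the squared speed is controlled by the energy, so a bound on the speed is sought in
  the form of a constant plus a multiple of its square. The choice \<open>c = 0\<close> serves where
  the speed is bounded below, a balanced choice replaces the Cauchy-Schwarz inequality.\<close>

lemma norm_diff_le_quadratic:
  assumes "0 \<le> a" "a \<le> b"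
    and AE: "AE t in lebesgue. a < t \<and> t < b \<longrightarrow> speed t \<le> c + k * (speed t)\<^sup>2"
  shows "norm (x b - x a) \<le> c * (b - a) + k * action a b"
proof -
  have hi: "((\<lambda>t. c + k * (speed t)\<^sup>2) has_integral (b - a) *\<^sub>R c + k * action a b) {a..b}"
    using has_integral_const_real[of c a b] assms
    by (intro has_integral_add has_integral_mult_right has_integral_action) auto
  have "norm (x b - x a) \<le> integral {a..b} (\<lambda>t. c + k * (speed t)\<^sup>2)"
  proof (rule norm_increment_le_integral)
    show "AE t in lebesgue. a < t \<and> t < b \<longrightarrow> x differentiable (at t) \<and> speed t \<le> c + k * (speed t)\<^sup>2"
      using AE diff by eventually_elim (use assms(1) in auto)
  qed (use hi assms ac in auto)
  then show ?thesis
    using integral_unique[OF hi] by (simp add: mult.commute)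
qed

text \<open>This is Cauchy-Schwarz on a unit interval, carried out as the weighted inequality
  between the means with weight \<open>m\<close>. The extra \<open>\<epsilon>\<close> keeps
  \<open>m\<close> positive when the energy gap vanishes.\<close>

lemma norm_diff_le_sqrt_energy:
  assumes "0 \<le> a"
  shows "norm (x (a + 1) - x a) \<le> sqrt ((e a - e\<^sub>0) / \<rho>)"
proof -
  have A: "action a (a + 1) \<le> (e a - e\<^sub>0) / \<rho>"
  proof -
    have "action a (a + 1) \<le> (e a - e (a + 1)) / \<rho>" using assms by (intro action_le) auto
    also have "\<dots> \<le> (e a - e\<^sub>0) / \<rho>"
      using lower[of "a + 1"] rho assms by (intro divide_right_mono) auto
    finally show ?thesis .
  qed
  have "norm (x (a + 1) - x a) \<le> sqrt ((e a - e\<^sub>0) / \<rho>) + \<epsilon>" if "\<epsilon> > 0" for \<epsilon>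
  proof -
    define m where "m = sqrt ((e a - e\<^sub>0) / \<rho>) + \<epsilon>"
    have "(e a - e\<^sub>0) / \<rho> \<ge> 0" using A action_nonneg order_trans by blast
    then have m: "m > 0" "(e a - e\<^sub>0) / \<rho> \<le> m\<^sup>2"
      using \<open>\<epsilon> > 0\<close> by (auto simp: m_def add_nonneg_pos intro!: sqrt_le_D)
    have am: "s \<le> m / 2 + 1 / (2 * m) * s\<^sup>2" for s :: real
    proof -
      have "0 \<le> (s - m)\<^sup>2 / (2 * m)" using m(1) by simp
      also have "\<dots> = m / 2 + 1 / (2 * m) * s\<^sup>2 - s"
        using m(1) by (simp add: power2_eq_square field_simps)
      finally show ?thesis by simp
    qed
    have "norm (x (a + 1) - x a) \<le> m / 2 * ((a + 1) - a) + 1 / (2 * m) * action a (a + 1)"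
      using assms by (intro norm_diff_le_quadratic AE_I2 impI am) auto
    also have "\<dots> \<le> m / 2 + 1 / (2 * m) * m\<^sup>2"
      using A m by (intro add_mono mult_left_mono) auto
    also have "\<dots> = m" using m(1) by (simp add: power2_eq_square)
    finally show ?thesis by (simp add: m_def)
  qed
  then show ?thesis by (rule field_le_epsilon)
qed

lemma action_lower_bound:
  assumes "0 \<le> a" "a \<le> b" and AE: "AE t in lebesgue. a \<le> t \<and> t \<le> b \<longrightarrow> c \<le> (speed t)\<^sup>2"
  shows "c * (b - a) \<le> action a b"
proof -
  have "(LINT r|lebesgue_on {a..b}. c) \<le> action a b"
    using AE by (intro integral_mono_AE sq_int assms finite_measure.integrable_const
        finite_measure_lebesgue_on) (auto simp: AE_restrict_space_iff)
  then show ?thesis using assms(2) by (simp add: measure_restrict_space mult.commute)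
qed

lemma exists_slow_time:
  assumes P: "AE t in lebesgue. t \<ge> 0 \<longrightarrow> P t" and "\<delta> > 0"
  shows "\<exists>t\<ge>T. P t \<and> speed t < \<delta>"
proof (rule ccontr)
  assume neg: "\<not> ?thesis"
  define T' where "T' = max T 0"
  \<comment> \<open>Keeping speed \<open>\<delta>\<close> until time \<open>b\<close> would cost 1
    more action than the remaining energy can pay.\<close>
  define b where "b = T' + ((e T' - e\<^sub>0) / \<rho> + 1) / \<delta>\<^sup>2"
  have T': "T' \<ge> 0" "T' \<ge> T" by (auto simp: T'_def)
  have "(e T' - e\<^sub>0) / \<rho> \<ge> 0" using lower[OF T'(1)] rho by simp
  then have b: "T' \<le> b" using \<open>\<delta> > 0\<close> by (simp add: b_def)
  have "AE t in lebesgue. T' \<le> t \<and> t \<le> b \<longrightarrow> \<delta>\<^sup>2 \<le> (speed t)\<^sup>2"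
    using P
  proof eventually_elim
    case (elim t)
    show ?case
    proof
      assume "T' \<le> t \<and> t \<le> b"
      then have "\<delta> \<le> speed t" using neg elim T' by force
      then show "\<delta>\<^sup>2 \<le> (speed t)\<^sup>2" using \<open>\<delta> > 0\<close> by (intro power_mono) auto
    qed
  qed
  from action_lower_bound[OF T'(1) b this]
  have "\<delta>\<^sup>2 * (b - T') \<le> (e T' - e b) / \<rho>"
    using action_le[OF T'(1) b] by linarith
  also have "\<dots> \<le> (e T' - e\<^sub>0) / \<rho>"
    using lower[of b] rho b T' by (intro divide_right_mono) auto
  finally show False using \<open>\<delta> > 0\<close> by (simp add: b_def)
qed

section \<open>Convergence to an omega-limit point\<close>

lemma energy_Cauchy:
  assumes "\<eta> > 0"
  obtains T where "T \<ge> 0" "\<And>s t. T \<le> s \<Longrightarrow> s \<le> t \<Longrightarrow> e s - e t < \<eta>"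
proof -
  have bdd: "bdd_below (e ` {0..})" using lower by (intro bdd_belowI2) auto
  then obtain T where T: "T \<ge> 0" "e T < Inf (e ` {0..}) + \<eta>"
    using cInf_lessD[of "e ` {0..}" "Inf (e ` {0..}) + \<eta>"] assms by auto
  have "e s - e t < \<eta>" if "T \<le> s" "s \<le> t" for s t
  proof -
    have "Inf (e ` {0..}) \<le> e t" using bdd that T by (intro cInf_lower) auto
    then show ?thesis using energy_mono[of T s] T that by linarith
  qed
  then show ?thesis using T that by blast
qed

text \<open>Crossing the shell between the radii \<open>\<epsilon> / 2\<close> and \<open>\<epsilon>\<close> costs a fixed amount of energy, since the
  speed is bounded below there.\<close>

lemma convergent_of_speed_bound:
  assumes \<omega>: "p \<in> omega_limit_set x" and "r > 0" "K > 0"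
    and AE: "AE t in lebesgue. t \<ge> 0 \<longrightarrow> x t \<in> ball p r \<longrightarrow> norm (x t - p) \<le> K * speed t"
  shows "(x \<longlongrightarrow> p) at_top"
proof (rule tendstoI)
  fix \<epsilon>' :: real assume "\<epsilon>' > 0"
  define \<epsilon> where "\<epsilon> = min \<epsilon>' r"
  have \<epsilon>: "\<epsilon> > 0" "\<epsilon> \<le> r" "\<epsilon> \<le> \<epsilon>'" using \<open>\<epsilon>' > 0\<close> \<open>r > 0\<close> by (auto simp: \<epsilon>_def)
  \<comment> \<open>With this budget the displacement bound
    \<open>2 * K / \<epsilon> * (\<eta> / \<rho>)\<close> equals the width
    \<open>\<epsilon> / 2\<close> of the shell.\<close>
  define \<eta> where "\<eta> = \<rho> * \<epsilon>\<^sup>2 / (4 * K)"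
  have "\<eta> > 0" using \<epsilon> rho \<open>K > 0\<close> by (simp add: \<eta>_def)
  then obtain T0 where T0: "T0 \<ge> 0" "\<And>s t. T0 \<le> s \<Longrightarrow> s \<le> t \<Longrightarrow> e s - e t < \<eta>"
    using energy_Cauchy by blast
  obtain \<tau> :: "nat \<Rightarrow> real" where \<tau>: "filterlim \<tau> at_top sequentially" "(\<lambda>n. x (\<tau> n)) \<longlonglongrightarrow> p"
    using \<omega> unfolding omega_limit_set_def by auto
  have "\<forall>\<^sub>F n in sequentially. T0 \<le> \<tau> n" using \<tau>(1) by (simp add: filterlim_at_top)
  moreover have "\<forall>\<^sub>F n in sequentially. dist (x (\<tau> n)) p < \<epsilon> / 2"
    using \<tau>(2) \<epsilon> by (intro tendstoD) auto
  ultimately have "\<forall>\<^sub>F n in sequentially. T0 \<le> \<tau> n \<and> dist (x (\<tau> n)) p < \<epsilon> / 2" by eventually_elim auto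
  then obtain n where "T0 \<le> \<tau> n \<and> dist (x (\<tau> n)) p < \<epsilon> / 2"
    using eventually_happens by fastforce
  then obtain T where T: "T0 \<le> T" "dist (x T) p < \<epsilon> / 2" by blast
  have cont: "continuous_on {T..} (\<lambda>s. dist (x s) p)"
    using T T0 by (intro continuous_intros continuous_on_subset[OF continuous_curve]) auto
  have "dist (x t) p < \<epsilon>" if "t \<ge> T" for t
  proof (rule ccontr)
    assume "\<not> dist (x t) p < \<epsilon>"
    \<comment> \<open>The minimum \<open>b\<close> of \<open>B\<close> is the first time at radius
      \<open>\<epsilon>\<close>, and the maximum \<open>a\<close> of the set \<open>A\<close> below
      is the last time before it at radius \<open>\<epsilon> / 2\<close>. Strictly between them the
      curve is inside the shell.\<close>
    define B where "B = {s \<in> {T..t}. \<epsilon> \<le> dist (x s) p}"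
    have "compact B"
      unfolding B_def by (intro compact_sublevel continuous_intros continuous_on_subset[OF cont]) auto
    moreover have "t \<in> B" using \<open>t \<ge> T\<close> \<open>\<not> dist (x t) p < \<epsilon>\<close> by (simp add: B_def)
    ultimately obtain b where b: "b \<in> B" "\<And>s. s \<in> B \<Longrightarrow> b \<le> s"
      using compact_attains_inf[of B] by blast
    define A where "A = {s \<in> {T..b}. dist (x s) p \<le> \<epsilon> / 2}"
    have "compact A"
      unfolding A_def by (intro compact_sublevel continuous_intros continuous_on_subset[OF cont]) auto
    moreover have "T \<in> A" using b(1) T by (simp add: A_def B_def)
    ultimately obtain a where a: "a \<in> A" "\<And>s. s \<in> A \<Longrightarrow> s \<le> a"
      using compact_attains_sup[of A] by blast
    have ab: "0 \<le> a" "a \<le> b" "T0 \<le> a" "T \<le> a" "b \<le> t" using a(1) b(1) T T0 by (auto simp: A_def B_def)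
    have shell: "\<epsilon> / 2 < dist (x s) p" "dist (x s) p < \<epsilon>" if "a < s" "s < b" for s
      using a(2)[of s] b(2)[of s] that ab by (force simp: A_def B_def)+
    have "norm (x b - x a) \<le> 0 * (b - a) + 2 * K / \<epsilon> * action a b"
    proof (rule norm_diff_le_quadratic[OF ab(1,2)])
      show "AE t in lebesgue. a < t \<and> t < b \<longrightarrow> speed t \<le> 0 + 2 * K / \<epsilon> * (speed t)\<^sup>2"
        using AE
      proof eventually_elim
        case (elim s)
        show ?case
        proof
          assume s: "a < s \<and> s < b"
          then have "\<epsilon> / 2 \<le> K * speed s"
            using elim shell[of s] \<epsilon> ab by (auto simp: dist_norm norm_minus_commute)
          then have "1 \<le> 2 * K / \<epsilon> * speed s" using \<epsilon> by (simp add: field_simps)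
          from mult_right_mono[OF this, of "speed s"]
          show "speed s \<le> 0 + 2 * K / \<epsilon> * (speed s)\<^sup>2" by (simp add: power2_eq_square mult.assoc)
        qed
      qed
    qed
    also have "\<dots> \<le> 2 * K / \<epsilon> * ((e a - e b) / \<rho>)"
      using mult_left_mono[OF action_le[OF ab(1,2)], of "2 * K / \<epsilon>"] \<open>K > 0\<close> \<epsilon> by simp
    also have "\<dots> < 2 * K / \<epsilon> * (\<eta> / \<rho>)"
      using T0(2)[OF ab(3,2)] \<open>K > 0\<close> \<epsilon> rho by (intro mult_strict_left_mono divide_strict_right_mono) auto
    also have "\<dots> = \<epsilon> / 2"
      using \<open>K > 0\<close> \<epsilon> rho by (simp add: \<eta>_def power2_eq_square field_simps)
    finally have "dist (x b) (x a) < \<epsilon> / 2" by (simp add: dist_norm)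
    moreover have "dist (x b) p \<ge> \<epsilon>" "dist (x a) p \<le> \<epsilon> / 2" using a(1) b(1) by (auto simp: A_def B_def)
    ultimately show False using dist_triangle[of "x b" p "x a"] by linarith
  qed
  then show "\<forall>\<^sub>F t in at_top. dist (x t) p < \<epsilon>'"
    using \<epsilon> by (intro eventually_at_top_linorderI[of T]) fastforce
qed

text \<open>As the energy decreases, the gap at \<open>t + 1\<close> is a lower bound for the gap on
  all of \<open>[t, t + 1]\<close>. The growth hypothesis turns it into a lower bound for the action
  there, so the energy drops by at least \<open>\<rho> / C\<close> times the final gap.\<close>

lemma energy_exponential_decay:
  assumes T: "T \<ge> 0" and "C > 0"
    and AE: "AE t in lebesgue. t \<ge> T \<longrightarrow> e t - e\<^sub>0 \<le> C * (speed t)\<^sup>2"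
  shows "\<exists>\<alpha>>0. \<exists>\<beta>>0. \<forall>t\<ge>T. e t - e\<^sub>0 \<le> \<alpha> * exp (- \<beta> * t)"
proof -
  define q where "q = 1 / (1 + \<rho> / C)"
  have q: "0 < q" "q < 1" using rho \<open>C > 0\<close> by (auto simp: q_def add_pos_pos)
  have step: "e (t + 1) - e\<^sub>0 \<le> q * (e t - e\<^sub>0)" if t: "t \<ge> T" for t
  proof -
    have "AE s in lebesgue. t \<le> s \<and> s \<le> t + 1 \<longrightarrow> (e (t + 1) - e\<^sub>0) / C \<le> (speed s)\<^sup>2"
      using AE
    proof eventually_elim
      case (elim s)
      show ?case
      proof
        assume s: "t \<le> s \<and> s \<le> t + 1"
        then have "e (t + 1) - e\<^sub>0 \<le> C * (speed s)\<^sup>2"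
          using elim energy_mono[of s "t + 1"] T t by auto
        then show "(e (t + 1) - e\<^sub>0) / C \<le> (speed s)\<^sup>2"
          using \<open>C > 0\<close> by (simp add: field_simps)
      qed
    qed
    from action_lower_bound[OF _ _ this] have "(e (t + 1) - e\<^sub>0) / C \<le> action t (t + 1)"
      using T t by simp
    also have "\<dots> \<le> (e t - e (t + 1)) / \<rho>" using T t by (intro action_le) auto
    finally have "(1 + \<rho> / C) * (e (t + 1) - e\<^sub>0) \<le> e t - e\<^sub>0"
      using rho \<open>C > 0\<close> by (simp add: field_simps)
    moreover have "1 + \<rho> / C > 0" using rho \<open>C > 0\<close> by (simp add: add_pos_pos)
    ultimately show ?thesis by (simp add: q_def field_simps)
  qed
  have iter: "e (T + real n) - e\<^sub>0 \<le> q ^ n * (e T - e\<^sub>0)" for n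
  proof (induction n)
    case (Suc n)
    have "e (T + real (Suc n)) - e\<^sub>0 \<le> q * (e (T + real n) - e\<^sub>0)"
      using step[of "T + real n"] by (simp add: add_ac)
    also have "\<dots> \<le> q * (q ^ n * (e T - e\<^sub>0))" using Suc q by (intro mult_left_mono) auto
    finally show ?case by simp
  qed simp
  define \<beta> where "\<beta> = - ln q"
  \<comment> \<open>The exponent pays for the starting time \<open>T\<close> and for rounding
    \<open>t - T\<close> down to an integer; the \<open>+ 1\<close> keeps \<open>\<alpha>\<close>
    positive when the gap is zero.\<close>
  define \<alpha> where "\<alpha> = (e T - e\<^sub>0) * exp (\<beta> * (T + 1)) + 1"
  have "\<beta> > 0" using q by (simp add: \<beta>_def)
  have eT: "e T - e\<^sub>0 \<ge> 0" using lower[OF T] by simp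
  have "\<alpha> > 0" using eT by (simp add: \<alpha>_def add_nonneg_pos)
  have "e t - e\<^sub>0 \<le> \<alpha> * exp (- \<beta> * t)" if t: "t \<ge> T" for t
  proof -
    define n where "n = nat \<lfloor>t - T\<rfloor>"
    have n: "real n \<le> t - T" "t - T \<le> real n + 1" using t by (auto simp: n_def)
    have "e t - e\<^sub>0 \<le> e (T + real n) - e\<^sub>0" using energy_mono[of "T + real n" t] T n by simp
    also have "\<dots> \<le> q ^ n * (e T - e\<^sub>0)" by (rule iter)
    also have "q ^ n = exp (- \<beta> * real n)"
      using q by (simp add: \<beta>_def mult.commute exp_of_nat_mult)
    also have "\<dots> * (e T - e\<^sub>0) \<le> exp (- \<beta> * (t - T - 1)) * (e T - e\<^sub>0)"
      using n \<open>\<beta> > 0\<close> eT by (intro mult_right_mono) auto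
    also have "\<dots> = (e T - e\<^sub>0) * exp (\<beta> * (T + 1)) * exp (- \<beta> * t)"
      by (simp add: exp_add[symmetric] algebra_simps)
    also have "\<dots> \<le> \<alpha> * exp (- \<beta> * t)" by (simp add: \<alpha>_def)
    finally show ?thesis .
  qed
  then show ?thesis using \<open>\<alpha> > 0\<close> \<open>\<beta> > 0\<close> by blast
qed

lemma curve_exponential_decay:
  assumes T: "T \<ge> 0" and lim: "(x \<longlongrightarrow> p) at_top" and "\<alpha> > 0" "\<beta> > 0"
    and dec: "\<And>t. t \<ge> T \<Longrightarrow> e t - e\<^sub>0 \<le> \<alpha> * exp (- \<beta> * t)"
  shows "\<exists>\<alpha>'>0. \<exists>\<beta>'>0. \<forall>t\<ge>T. norm (x t - p) \<le> \<alpha>' * exp (- \<beta>' * t)"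
proof -
  \<comment> \<open>Displacement is controlled by the square root of the energy gap, which halves
    the rate.\<close>
  define \<beta>' where "\<beta>' = \<beta> / 2"
  define c where "c = sqrt (\<alpha> / \<rho>)"
  define q where "q = exp (- \<beta>')"
  have q: "0 < q" "q < 1" using \<open>\<beta> > 0\<close> by (auto simp: q_def \<beta>'_def)
  have "c > 0" using \<open>\<alpha> > 0\<close> rho by (simp add: c_def)
  have step: "norm (x (t + 1) - x t) \<le> c * exp (- \<beta>' * t)" if t: "t \<ge> T" for t
  proof -
    have "norm (x (t + 1) - x t) \<le> sqrt ((e t - e\<^sub>0) / \<rho>)"
      using T t by (intro norm_diff_le_sqrt_energy) auto
    also have "\<dots> \<le> sqrt (\<alpha> * exp (- \<beta> * t) / \<rho>)"
      using dec[OF t] rho by (intro real_sqrt_le_mono divide_right_mono) auto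
    also have "\<alpha> * exp (- \<beta> * t) / \<rho> = \<alpha> / \<rho> * (exp (- \<beta>' * t))\<^sup>2"
      by (simp add: \<beta>'_def power2_eq_square exp_add[symmetric])
    also have "sqrt \<dots> = c * exp (- \<beta>' * t)"
      by (simp only: real_sqrt_mult real_sqrt_abs abs_exp_cancel c_def)
    finally show ?thesis .
  qed
  have sum: "norm (x (t + real n) - x t) \<le> c * exp (- \<beta>' * t) * (\<Sum>k<n. q ^ k)" if t: "t \<ge> T" for t n
  proof (induction n)
    case (Suc n)
    have "norm (x (t + real (Suc n)) - x t) \<le> norm (x (t + real n + 1) - x (t + real n)) + norm (x (t + real n) - x t)"
      using norm_triangle_ineq[of "x (t + real n + 1) - x (t + real n)" "x (t + real n) - x t"]
      by (simp add: add_ac)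
    also have "\<dots> \<le> c * exp (- \<beta>' * (t + real n)) + c * exp (- \<beta>' * t) * (\<Sum>k<n. q ^ k)"
      using t Suc by (intro add_mono step) auto
    also have "exp (- \<beta>' * (t + real n)) = exp (- \<beta>' * t) * q ^ n"
      by (simp add: q_def exp_of_nat_mult[symmetric] exp_add[symmetric] algebra_simps)
    finally show ?case by (simp add: algebra_simps)
  qed simp
  have "norm (p - x t) \<le> c / (1 - q) * exp (- \<beta>' * t)" if t: "t \<ge> T" for t
  proof (rule tendsto_upperbound)
    have "filterlim (\<lambda>n. t + real n) at_top sequentially" by real_asymp
    then show "(\<lambda>n. norm (x (t + real n) - x t)) \<longlonglongrightarrow> norm (p - x t)"
      by (intro tendsto_intros filterlim_compose[OF lim])
    have "norm (x (t + real n) - x t) \<le> c / (1 - q) * exp (- \<beta>' * t)" for n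
    proof -
      have "(\<Sum>k<n. q ^ k) \<le> 1 / (1 - q)"
        using q by (simp add: sum_gp_strict field_simps)
      then have "c * exp (- \<beta>' * t) * (\<Sum>k<n. q ^ k) \<le> c * exp (- \<beta>' * t) * (1 / (1 - q))"
        using \<open>c > 0\<close> by (intro mult_left_mono) auto
      then show ?thesis using sum[OF t, of n] by simp
    qed
    then show "\<forall>\<^sub>F n in sequentially. norm (x (t + real n) - x t) \<le> c / (1 - q) * exp (- \<beta>' * t)"
      by simp
  qed simp
  moreover have "c / (1 - q) > 0" "\<beta>' > 0" using q \<open>c > 0\<close> \<open>\<beta> > 0\<close> by (auto simp: \<beta>'_def)
  ultimately show ?thesis by (metis norm_minus_commute)
qed

text \<open>The energy inequality concerns bounded intervals, with a bound that does not depend on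
  their length; monotone convergence carries it to the half-line.\<close>

lemma nn_integral_le_energy:
  assumes t: "T \<le> t" "0 \<le> T" and D: "D \<in> borel_measurable (lebesgue_on {T..})" and "L \<ge> 0"
    and AE: "AE s in lebesgue. s \<ge> T \<longrightarrow> D s \<le> ennreal (L * speed s)"
  shows "(\<integral>\<^sup>+ s. (D s)\<^sup>2 \<partial>lebesgue_on {t..}) \<le> ennreal (L\<^sup>2 * ((e t - e\<^sub>0) / \<rho>))"
proof -
  define f where "f n s = (D s)\<^sup>2 * indicator {t..t + real n} s" for n s
  have meas: "(\<lambda>s. (D s)\<^sup>2) \<in> borel_measurable (lebesgue_on {t..})"
    using measurable_restrict_mono[OF D, of "{t..}"] t unfolding power2_eq_square by (intro borel_measurable_times_ennreal) auto
  have fin: "(\<integral>\<^sup>+ s. f n s \<partial>lebesgue_on {t..}) \<le> ennreal (L\<^sup>2 * ((e t - e\<^sub>0) / \<rho>))" for n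
  proof -
    have "(\<integral>\<^sup>+ s. f n s \<partial>lebesgue_on {t..}) = (\<integral>\<^sup>+ s. (D s)\<^sup>2 \<partial>lebesgue_on {t..t + real n})"
      unfolding f_def
      by (subst (1 2) nn_integral_restrict_space)
        (auto simp: indicator_def intro!: nn_integral_cong)
    also have "\<dots> \<le> (\<integral>\<^sup>+ s. ennreal (L\<^sup>2 * (speed s)\<^sup>2) \<partial>lebesgue_on {t..t + real n})"
    proof (rule nn_integral_mono_AE)
      show "AE s in lebesgue_on {t..t + real n}. (D s)\<^sup>2 \<le> ennreal (L\<^sup>2 * (speed s)\<^sup>2)"
        using AE
      proof (simp add: AE_restrict_space_iff, eventually_elim)
        case (elim s)
        show ?case
        proof
          assume "t \<le> s \<and> s \<le> t + real n"
          then have "(D s)\<^sup>2 \<le> (ennreal (L * speed s))\<^sup>2" using elim t by (intro power_mono) auto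
          then show "(D s)\<^sup>2 \<le> ennreal (L\<^sup>2 * (speed s)\<^sup>2)"
            using \<open>L \<ge> 0\<close> by (simp add: ennreal_power power_mult_distrib)
        qed
      qed
    qed
    also have "\<dots> = ennreal (L\<^sup>2 * action t (t + real n))"
      using sq_int[of t "t + real n"] t by (subst nn_integral_eq_integral) auto
    also have "\<dots> \<le> ennreal (L\<^sup>2 * ((e t - e\<^sub>0) / \<rho>))"
    proof (intro ennreal_leI mult_left_mono)
      have "action t (t + real n) \<le> (e t - e (t + real n)) / \<rho>" using t by (intro action_le) auto
      also have "\<dots> \<le> (e t - e\<^sub>0) / \<rho>" using t rho lower[of "t + real n"] by (intro divide_right_mono) auto
      finally show "action t (t + real n) \<le> (e t - e\<^sub>0) / \<rho>" .
    qed simp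
    finally show ?thesis .
  qed
  have "(\<integral>\<^sup>+ s. (D s)\<^sup>2 \<partial>lebesgue_on {t..}) = (\<integral>\<^sup>+ s. (SUP n. f n s) \<partial>lebesgue_on {t..})"
  proof (rule nn_integral_cong)
    fix s assume "s \<in> space (lebesgue_on {t..})"
    then have s: "s \<ge> t" by simp
    obtain n where "s - t \<le> real n" using real_arch_simple by blast
    then have "f n s = (D s)\<^sup>2" using s by (simp add: f_def)
    then show "(D s)\<^sup>2 = (SUP n. f n s)"
      by (intro antisym SUP_upper2[of n] SUP_least) (auto simp: f_def indicator_def)
  qed
  also have "\<dots> = (SUP n. \<integral>\<^sup>+ s. f n s \<partial>lebesgue_on {t..})"
  proof (rule nn_integral_monotone_convergence_SUP)
    show "incseq f"
      by (auto simp: incseq_def le_fun_def f_def indicator_def)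
    show "f n \<in> borel_measurable (lebesgue_on {t..})" for n
      unfolding f_def
      by (intro borel_measurable_times_ennreal meas borel_measurable_indicator)
        (auto simp: sets_restrict_space_iff)
  qed
  also have "\<dots> \<le> ennreal (L\<^sup>2 * ((e t - e\<^sub>0) / \<rho>))"
    by (intro SUP_least fin)
  finally show ?thesis .
qed

end

text \<open>This isolates what cases (i) and (ii) must supply: closedness of the subdifferential, a
  subgradient dominated by the speed, and an energy gap dominated by the squared speed.\<close>

lemma (in dissipative_curve) energy_integral_sandwich:
  fixes G :: "'a \<Rightarrow> 'b::euclidean_space set"
  assumes T: "T \<ge> 0" and B: "\<And>t. t \<ge> T \<Longrightarrow> x t \<in> B" and L: "L > 0" and C: "C > 0"
    and closed: "\<And>Y y Z \<zeta>. \<lbrakk>y \<in> B; Y \<longlonglongrightarrow> y; Z \<longlonglongrightarrow> \<zeta>; \<And>n. Z n \<in> G (Y n)\<rbrakk> \<Longrightarrow> \<zeta> \<in> G y"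
    and small: "AE t in lebesgue. t \<ge> T \<longrightarrow> (\<exists>u\<in>G (x t). norm u \<le> L * speed t)"
    and growth: "AE t in lebesgue. t \<ge> T \<longrightarrow> e t - e\<^sub>0 \<le> C * (speed t)\<^sup>2"
  shows "\<exists>\<alpha>>0. \<exists>\<beta>>0. \<exists>\<gamma>>0.
          (\<lambda>s. set_edist 0 (G (x s))) \<in> borel_measurable (lebesgue_on {T..}) \<and>
          (\<forall>t\<ge>T.
            ereal \<gamma> * enn2ereal (\<integral>\<^sup>+ s. (set_edist 0 (G (x s)))\<^sup>2 \<partial>lebesgue_on {t..}) \<le> ereal (e t - e\<^sub>0) \<and>
            e t - e\<^sub>0 \<le> \<alpha> * exp (- \<beta> * t))"
proof -
  let ?D = "\<lambda>s. set_edist 0 (G (x s))"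
  have meas: "?D \<in> borel_measurable (lebesgue_on {T..})"
  proof (rule set_edist_measurable_along_curve[OF _ B closed])
    show "continuous_on {T..} x"
      using T by (intro continuous_on_subset[OF continuous_curve]) auto
  qed auto
  have "AE s in lebesgue. s \<ge> T \<longrightarrow> ?D s \<le> ennreal (L * speed s)"
    using small
  proof eventually_elim
    case (elim s)
    then show ?case by (meson set_edist_0_le order_trans ennreal_leI)
  qed
  then have int: "(\<integral>\<^sup>+ s. (?D s)\<^sup>2 \<partial>lebesgue_on {t..}) \<le> ennreal (L\<^sup>2 * ((e t - e\<^sub>0) / \<rho>))" if "t \<ge> T" for t
    using nn_integral_le_energy[OF that T meas] L by simp
  have "ereal (\<rho> / L\<^sup>2) * enn2ereal (\<integral>\<^sup>+ s. (?D s)\<^sup>2 \<partial>lebesgue_on {t..}) \<le> ereal (e t - e\<^sub>0)" if t: "t \<ge> T" for t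
  proof -
    have "0 \<le> L\<^sup>2 * ((e t - e\<^sub>0) / \<rho>)" using lower[of t] T t rho by simp
    then have "enn2ereal (\<integral>\<^sup>+ s. (?D s)\<^sup>2 \<partial>lebesgue_on {t..}) \<le> ereal (L\<^sup>2 * ((e t - e\<^sub>0) / \<rho>))"
      using int[OF t] by (metis enn2ereal_ennreal less_eq_ennreal.rep_eq)
    then have "ereal (\<rho> / L\<^sup>2) * enn2ereal (\<integral>\<^sup>+ s. (?D s)\<^sup>2 \<partial>lebesgue_on {t..})
        \<le> ereal (\<rho> / L\<^sup>2) * ereal (L\<^sup>2 * ((e t - e\<^sub>0) / \<rho>))"
      using rho by (intro ereal_mult_left_mono) auto
    also have "\<dots> = ereal (e t - e\<^sub>0)" using rho L by simp
    finally show ?thesis .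
  qed
  moreover obtain \<alpha> \<beta> where "\<alpha> > 0" "\<beta> > 0" "\<forall>t\<ge>T. e t - e\<^sub>0 \<le> \<alpha> * exp (- \<beta> * t)"
    using energy_exponential_decay[OF T C growth] by blast
  moreover have "\<rho> / L\<^sup>2 > 0" using rho L by simp
  ultimately show ?thesis using meas by blast
qed

section \<open>Strong metric subregularity and convergence of energetic solutions\<close>

theorem theorem4p3:
  fixes \<phi>1 \<phi> :: "'a::euclidean_space \<Rightarrow> ereal"
    and \<phi>2 :: "'a \<Rightarrow> real"
    and F :: "'a \<Rightarrow> 'a"
    and x0 xstar :: 'a
    and \<Omega> :: "'a set"
    and x :: "real \<Rightarrow> 'a"
    and \<kappa> :: real
  assumes "\<And>y. \<phi>1 y \<noteq> - \<infinity>"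
    and "lsc_on UNIV \<phi>1"
    and "lsc_on UNIV (\<lambda>y. ereal (\<phi>2 y))"
    and "\<phi> = (\<lambda>y. \<phi>1 y + ereal (\<phi>2 y))"
    and "\<phi> x0 < \<infinity>"
    and "open \<Omega>"
    and "{y. \<phi> y \<le> \<phi> x0} \<subseteq> \<Omega>"
    and "primal_lower_regular_on \<Omega> \<phi>1"
    and "locally_lipschitz_on \<Omega> \<phi>2"
    and "locally_lipschitz_on \<Omega> F"
    and "is_solution \<phi>1 (\<lambda>y. ereal (\<phi>2 y)) F x0 x"
    and "energetic \<phi> x"
    and "xstar \<in> omega_limit_set x"
    and "\<kappa> > 0"
    and "strongly_metrically_subregular
      (\<lambda>y. {v + w | v w. v \<in> clarke_subdifferential \<phi>1 y \<and>
        w \<in> clarke_subdifferential (\<lambda>z. ereal (\<phi>2 z)) y}) xstar 0 \<kappa>"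
  shows "(x \<longlongrightarrow> xstar) at_top
    \<and> (\<exists>\<sigma>0>0. \<exists>T>0. \<exists>\<nu>>0.
        (\<forall>s t. T \<le> s \<and> s \<le> t \<longrightarrow>
          ereal (\<sigma>0 * (LINT r|lebesgue_on {s..t}. (norm (x r - xstar))\<^sup>2)) \<le> \<phi> (x s) - \<phi> (x t)) \<and>
        (\<forall>t>T. \<exists>s. is_arg_min (\<lambda>r. norm (x r - xstar)) (\<lambda>r. r \<in> {T..t}) s \<and>
          norm (x s - xstar) \<le> \<nu> / sqrt (t - T)))
    \<and> (((\<exists>\<sigma>. weakly_convex_around \<sigma> \<phi>1 xstar) \<and> \<phi>2 = (\<lambda>_. 0)) \<or>
       (\<phi>1 = (\<lambda>_. 0) \<and> (\<exists>\<sigma>. weakly_convex_around \<sigma> (\<lambda>y. ereal (- \<phi>2 y)) xstar)) \<longrightarrow>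
       (\<exists>\<alpha>>0. \<exists>\<beta>>0. \<exists>\<gamma>>0. \<exists>\<tau>>0.
          (\<lambda>s. set_edist 0 (clarke_subdifferential \<phi> (x s))) \<in> borel_measurable (lebesgue_on {\<tau>..}) \<and>
          (\<forall>t\<ge>\<tau>.
            ereal \<gamma> * enn2ereal
                (\<integral>\<^sup>+ s. (set_edist 0 (clarke_subdifferential \<phi> (x s)))\<^sup>2 \<partial>lebesgue_on {t..})
              \<le> \<phi> (x t) - \<phi> xstar \<and>
            \<phi> (x t) - \<phi> xstar \<le> ereal (\<alpha> * exp (- \<beta> * t)))))
    \<and> ((\<exists>\<sigma>. weakly_convex_around \<sigma> \<phi>1 xstar \<and> \<sigma> < inverse \<kappa>) \<and> \<phi>2 = (\<lambda>_. 0) \<longrightarrow>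
       (\<exists>\<alpha>>0. \<exists>\<beta>>0. \<exists>\<tau>>0. \<forall>t\<ge>\<tau>. norm (x t - xstar) \<le> \<alpha> * exp (- \<beta> * t)))"
proof -

  \<comment> \<open>Energy along the trajectory and its lower bound\<close>
  define e where "e t = real_of_ereal (\<phi> (x t))" for t
  define es where "es = real_of_ereal (\<phi> xstar)"
  let ?speed = "\<lambda>t. norm (vector_derivative x (at t))"
  let ?action = "\<lambda>a b. LINT r|lebesgue_on {a..b}. (?speed r)\<^sup>2"
  note phi = \<open>\<phi> = (\<lambda>y. \<phi>1 y + ereal (\<phi>2 y))\<close>
  have phi_minf: "\<phi> y \<noteq> - \<infinity>" for y
    using assms(1)[of y] by (cases "\<phi>1 y") (auto simp: phi)
  have x0: "x 0 = x0" and ac: "\<And>a b. 0 \<le> a \<Longrightarrow> a \<le> b \<Longrightarrow> absolutely_continuous_on_interval a b x"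
    using assms(11) unfolding is_solution_def by auto
  obtain v w where sol: "AE t in lebesgue. t \<ge> 0 \<longrightarrow>
        v t \<in> clarke_subdifferential \<phi>1 (x t) \<and> w t \<in> clarke_subdifferential (\<lambda>y. ereal (\<phi>2 y)) (x t) \<and>
        (\<exists>x'. (x has_vector_derivative x') (at t) \<and>
          v t + w t \<in> uminus ` graphical_derivative F (x t) x')"
    using assms(11) unfolding is_solution_def by auto
  obtain \<rho> where "\<rho> > 0" and en: "\<And>s t. 0 \<le> s \<Longrightarrow> s < t \<Longrightarrow>
      integrable (lebesgue_on {s..t}) (\<lambda>r. (?speed r)\<^sup>2) \<and> ereal (\<rho> * ?action s t) \<le> \<phi> (x s) - \<phi> (x t)"
    using assms(12) unfolding energetic_def by blast
  have phi_e: "\<phi> (x t) = ereal (e t)" if "t \<ge> 0" for t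
  proof -
    have "\<phi> (x 0) < \<infinity>" using assms(5) x0 by simp
    then have "\<phi> (x t) \<noteq> \<infinity>"
      using en[of 0 t] that phi_minf[of "x 0"] by (cases "t = 0"; cases "\<phi> (x 0)") auto
    then show ?thesis using phi_minf[of "x t"] by (cases "\<phi> (x t)") (auto simp: e_def)
  qed
  have sq_int: "integrable (lebesgue_on {a..b}) (\<lambda>r. (?speed r)\<^sup>2)" if "0 \<le> a" "a \<le> b" for a b
  proof (rule Equivalence_Lebesgue_Henstock_Integration.integrable_subinterval)
    \<comment> \<open>\<open>energetic\<close> speaks of nondegenerate intervals only; enlarging to
      \<open>b + 1\<close> includes \<open>a = b\<close>.\<close>
    show "integrable (lebesgue_on {a..b + 1}) (\<lambda>r. (?speed r)\<^sup>2)"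
      using en[of a "b + 1"] that by simp
  qed simp
  have diss: "\<rho> * ?action a b \<le> e a - e b" if "0 \<le> a" "a \<le> b" for a b
  proof (cases "a = b")
    case True
    then show ?thesis using lebesgue_integral_eq_integral[OF sq_int[OF that]] by simp
  next
    case False
    then show ?thesis using en[of a b] that by (simp add: phi_e)
  qed
  have e_mono: "e b \<le> e a" if "0 \<le> a" "a \<le> b" for a b
  proof -
    have "0 \<le> ?action a b" by (rule integral_nonneg_AE) simp
    then have "0 \<le> \<rho> * ?action a b" using \<open>\<rho> > 0\<close> by simp
    then show ?thesis using diss[OF that] by linarith
  qed
  obtain \<tau> :: "nat \<Rightarrow> real" where \<tau>: "filterlim \<tau> at_top sequentially" "(\<lambda>n. x (\<tau> n)) \<longlonglongrightarrow> xstar"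
    using assms(13) unfolding omega_limit_set_def by auto
  \<comment> \<open>Otherwise lower semicontinuity would lift the energy at late times
    \<open>\<tau> n\<close> above \<open>e t\<close>, against monotonicity.\<close>
  have phi_star_le: "\<phi> xstar \<le> ereal (e t)" if "t \<ge> 0" for t
  proof (rule ccontr)
    assume "\<not> \<phi> xstar \<le> ereal (e t)"
    then have "\<forall>\<^sub>F n in sequentially. ereal (e t) < \<phi> (x (\<tau> n))"
      using eventually_less_add_lsc[OF assms(2,3) \<tau>(2)] by (simp add: phi)
    moreover have "\<forall>\<^sub>F n in sequentially. t \<le> \<tau> n" using \<tau>(1) by (simp add: filterlim_at_top)
    ultimately have "\<forall>\<^sub>F n in sequentially. False"
    proof eventually_elim
      case (elim n)
      then show ?case using e_mono[of t "\<tau> n"] phi_e[of "\<tau> n"] that by simp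
    qed
    then show False by simp
  qed
  then have phi_star: "\<phi> xstar = ereal es"
    using phi_star_le[of 0] phi_minf[of xstar] by (cases "\<phi> xstar") (auto simp: es_def)
  have es_le: "es \<le> e t" if "t \<ge> 0" for t using phi_star_le[OF that] phi_star by simp
  have "xstar \<in> \<Omega>"
    using assms(7) phi_star_le[of 0] phi_e[of 0] x0 by auto
  have diff: "AE t in lebesgue. t \<ge> 0 \<longrightarrow> x differentiable (at t)"
    using sol by eventually_elim (auto simp: differentiableI_vector)
  interpret dissipative_curve x e es \<rho>
    by unfold_locales (use ac diff sq_int diss es_le \<open>\<rho> > 0\<close> in auto)

  \<comment> \<open>Speed bound near the limit point and convergence\<close>
  obtain SF L0 where SF: "open SF" "xstar \<in> SF" "L0-lipschitz_on SF F"
    using locally_lipschitz_on_obtains[OF assms(10,6) \<open>xstar \<in> \<Omega>\<close>] .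
  \<comment> \<open>The \<open>+ 1\<close> makes \<open>L\<close>, and with it \<open>K\<close>,
    positive, so that both can be divided by.\<close>
  define L where "L = L0 + 1"
  have L: "L > 0" "L0 \<le> L" using lipschitz_on_nonneg[OF SF(3)] by (auto simp: L_def)
  obtain U where U: "xstar \<in> interior U" and sms: "\<And>y. y \<in> U \<Longrightarrow> ennreal (norm (y - xstar)) \<le> ennreal \<kappa> *
      set_edist 0 {v + w | v w. v \<in> clarke_subdifferential \<phi>1 y \<and> w \<in> clarke_subdifferential (\<lambda>z. ereal (\<phi>2 z)) y}"
    using assms(15) unfolding strongly_metrically_subregular_def by auto
  have "open (SF \<inter> interior U)" "xstar \<in> SF \<inter> interior U" using SF U by auto
  then obtain r where r: "r > 0" "ball xstar r \<subseteq> SF \<inter> interior U"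
    by (meson openE)
  \<comment> \<open>Subregularity contributes \<open>\<kappa>\<close>, the Lipschitz bound on the
    graphical derivative contributes \<open>L\<close>.\<close>
  define K where "K = \<kappa> * L"
  have K: "K > 0" using L \<open>\<kappa> > 0\<close> by (simp add: K_def)
  have basic: "AE t in lebesgue. t \<ge> 0 \<longrightarrow> x t \<in> ball xstar r \<longrightarrow>
      v t \<in> clarke_subdifferential \<phi>1 (x t) \<and> w t \<in> clarke_subdifferential (\<lambda>y. ereal (\<phi>2 y)) (x t) \<and>
      norm (v t + w t) \<le> L * speed t \<and> norm (x t - xstar) \<le> K * speed t"
    using sol
  proof eventually_elim
    case (elim t)
    show ?case
    proof (intro impI)
      assume t: "t \<ge> 0" "x t \<in> ball xstar r"
      then obtain x' u where x': "(x has_vector_derivative x') (at t)"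
        and u: "u \<in> graphical_derivative F (x t) x'" "v t + w t = - u"
        and vw: "v t \<in> clarke_subdifferential \<phi>1 (x t)" "w t \<in> clarke_subdifferential (\<lambda>y. ereal (\<phi>2 y)) (x t)"
        using elim by auto
      have "norm u \<le> L0 * norm x'"
        using t r by (intro graphical_derivative_norm_le[OF u(1) _ SF(1,3)]) auto
      also have "\<dots> \<le> L * speed t"
        using L vector_derivative_at[OF x'] by (simp add: mult_right_mono)
      finally have n: "norm (v t + w t) \<le> L * speed t" using u by simp
      have "x t \<in> U" using t r interior_subset by blast
      from sms[OF this] have "ennreal (norm (x t - xstar)) \<le> ennreal \<kappa> * ennreal (norm (v t + w t))"
        by (rule order_trans) (use vw in \<open>auto intro!: mult_left_mono set_edist_0_le\<close>)
      then have "norm (x t - xstar) \<le> \<kappa> * norm (v t + w t)"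
        using \<open>\<kappa> > 0\<close> by (simp add: ennreal_mult[symmetric] ennreal_le_iff)
      also have "\<dots> \<le> \<kappa> * (L * speed t)" using n \<open>\<kappa> > 0\<close> by (intro mult_left_mono) auto
      finally show "v t \<in> clarke_subdifferential \<phi>1 (x t) \<and> w t \<in> clarke_subdifferential (\<lambda>y. ereal (\<phi>2 y)) (x t) \<and>
        norm (v t + w t) \<le> L * speed t \<and> norm (x t - xstar) \<le> K * speed t"
        using vw n by (simp add: K_def mult.assoc)
    qed
  qed
  have lim: "(x \<longlongrightarrow> xstar) at_top"
  proof (rule convergent_of_speed_bound[OF assms(13) r(1) K])
    show "AE t in lebesgue. t \<ge> 0 \<longrightarrow> x t \<in> ball xstar r \<longrightarrow> norm (x t - xstar) \<le> K * speed t"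
      using basic by eventually_elim auto
  qed
  have tail: "\<exists>T\<ge>1. \<forall>t\<ge>T. x t \<in> W" if "open W" "xstar \<in> W" for W
  proof -
    have "\<forall>\<^sub>F t in at_top. x t \<in> W \<and> 1 \<le> t"
      using topological_tendstoD[OF lim that] eventually_ge_at_top[of 1] by eventually_elim auto
    then obtain T where "\<forall>t\<ge>T. x t \<in> W \<and> 1 \<le> t" by (auto simp: eventually_at_top_linorder)
    then show ?thesis by (intro exI[of _ T]) auto
  qed
  have phi_diff: "\<phi> (x s) - \<phi> (x t) = ereal (e s - e t)" if "s \<ge> 0" "t \<ge> 0" for s t
    using that by (simp add: phi_e)
  have phi_diff_star: "\<phi> (x t) - \<phi> xstar = ereal (e t - es)" if "t \<ge> 0" for t
    using that by (simp add: phi_e phi_star)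

  \<comment> \<open>Integral estimate and rate for the minimal distance\<close>
  have part2: "\<exists>\<sigma>0>0. \<exists>T>0. \<exists>\<nu>>0.
        (\<forall>s t. T \<le> s \<and> s \<le> t \<longrightarrow>
          ereal (\<sigma>0 * (LINT r|lebesgue_on {s..t}. (norm (x r - xstar))\<^sup>2)) \<le> \<phi> (x s) - \<phi> (x t)) \<and>
        (\<forall>t>T. \<exists>s. is_arg_min (\<lambda>r. norm (x r - xstar)) (\<lambda>r. r \<in> {T..t}) s \<and>
          norm (x s - xstar) \<le> \<nu> / sqrt (t - T))"
  proof -
    obtain T where T: "T \<ge> 1" "\<And>t. t \<ge> T \<Longrightarrow> x t \<in> ball xstar r"
      using tail[of "ball xstar r"] r by auto
    \<comment> \<open>Squaring the speed bound costs the factor \<open>K\<^sup>2\<close>.\<close>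
    define \<sigma>0 where "\<sigma>0 = \<rho> / K\<^sup>2"
    define \<nu> where "\<nu> = sqrt ((e T - es) / \<sigma>0) + 1"
    have "\<sigma>0 > 0" using \<open>\<rho> > 0\<close> K by (simp add: \<sigma>0_def)
    have eT: "(e T - es) / \<sigma>0 \<ge> 0" using es_le[of T] T \<open>\<sigma>0 > 0\<close> by simp
    then have "\<nu> > 0" by (simp add: \<nu>_def add_nonneg_pos)
    have cont: "continuous_on {s..t} (\<lambda>r. norm (x r - xstar))" if "T \<le> s" for s t
      using that T by (intro continuous_intros continuous_on_subset[OF continuous_curve]) auto
    have int: "integrable (lebesgue_on {s..t}) (\<lambda>r. (norm (x r - xstar))\<^sup>2)" if "T \<le> s" for s t
      by (intro continuous_imp_integrable_real continuous_intros cont[OF that])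
    have dist_int: "\<sigma>0 * (LINT r|lebesgue_on {s..t}. (norm (x r - xstar))\<^sup>2) \<le> e s - e t"
      if st: "T \<le> s" "s \<le> t" for s t
    proof -
      have "(LINT r|lebesgue_on {s..t}. (norm (x r - xstar))\<^sup>2) \<le> (LINT r|lebesgue_on {s..t}. K\<^sup>2 * (speed r)\<^sup>2)"
      proof (intro integral_mono_AE int integrable_mult_right sq_int)
        have "AE r in lebesgue. r \<in> {s..t} \<longrightarrow> (norm (x r - xstar))\<^sup>2 \<le> K\<^sup>2 * (speed r)\<^sup>2"
          using basic
        proof eventually_elim
          case (elim u)
          show ?case
          proof
            assume "u \<in> {s..t}"
            then have "norm (x u - xstar) \<le> K * speed u" using elim T st by auto
            then show "(norm (x u - xstar))\<^sup>2 \<le> K\<^sup>2 * (speed u)\<^sup>2"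
              using power_mono[of "norm (x u - xstar)" "K * speed u" 2] by (simp add: power_mult_distrib)
          qed
        qed
        then show "AE r in lebesgue_on {s..t}. (norm (x r - xstar))\<^sup>2 \<le> K\<^sup>2 * (speed r)\<^sup>2"
          by (simp add: AE_restrict_space_iff)
      qed (use T st in auto)
      then have "\<sigma>0 * (LINT r|lebesgue_on {s..t}. (norm (x r - xstar))\<^sup>2) \<le> \<sigma>0 * (K\<^sup>2 * action s t)"
        using \<open>\<sigma>0 > 0\<close> by (intro mult_left_mono) auto
      also have "\<dots> = \<rho> * action s t" using K by (simp add: \<sigma>0_def)
      also have "\<dots> \<le> e s - e t" using T st by (intro diss) auto
      finally show ?thesis .
    qed
    moreover have "\<exists>s. is_arg_min (\<lambda>r. norm (x r - xstar)) (\<lambda>r. r \<in> {T..t}) s \<and>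
          norm (x s - xstar) \<le> \<nu> / sqrt (t - T)" if t: "t > T" for t
    proof -
      obtain s where s: "s \<in> {T..t}" "\<And>r. r \<in> {T..t} \<Longrightarrow> norm (x s - xstar) \<le> norm (x r - xstar)"
        using continuous_attains_inf[of "{T..t}" "\<lambda>r. norm (x r - xstar)"] cont[of T t] t by auto
      \<comment> \<open>The squared minimum is at most the mean of the squared distance over
        \<open>{T..t}\<close>.\<close>
      have "(LINT r|lebesgue_on {T..t}. (norm (x s - xstar))\<^sup>2) \<le> (LINT r|lebesgue_on {T..t}. (norm (x r - xstar))\<^sup>2)"
        using s by (intro integral_mono int finite_measure.integrable_const finite_measure_lebesgue_on) auto
      then have "(t - T) * (norm (x s - xstar))\<^sup>2 \<le> (LINT r|lebesgue_on {T..t}. (norm (x r - xstar))\<^sup>2)"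
        using t by (simp add: measure_restrict_space)
      also have "\<dots> \<le> (e T - e t) / \<sigma>0"
        using dist_int[of T t] t \<open>\<sigma>0 > 0\<close> by (simp add: field_simps)
      also have "\<dots> \<le> (e T - es) / \<sigma>0"
        using es_le[of t] T t \<open>\<sigma>0 > 0\<close> by (intro divide_right_mono) auto
      finally have "sqrt ((t - T) * (norm (x s - xstar))\<^sup>2) \<le> sqrt ((e T - es) / \<sigma>0)"
        by (rule real_sqrt_le_mono)
      then have "norm (x s - xstar) * sqrt (t - T) \<le> \<nu>"
        by (simp add: real_sqrt_mult \<nu>_def mult.commute)
      then have "norm (x s - xstar) \<le> \<nu> / sqrt (t - T)"
        using t by (simp add: pos_le_divide_eq)
      then show ?thesis using s by (auto simp: is_arg_min_linorder)
    qed
    ultimately have "(\<forall>s t. T \<le> s \<and> s \<le> t \<longrightarrow>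
          ereal (\<sigma>0 * (LINT r|lebesgue_on {s..t}. (norm (x r - xstar))\<^sup>2)) \<le> \<phi> (x s) - \<phi> (x t)) \<and>
        (\<forall>t>T. \<exists>s. is_arg_min (\<lambda>r. norm (x r - xstar)) (\<lambda>r. r \<in> {T..t}) s \<and>
          norm (x s - xstar) \<le> \<nu> / sqrt (t - T))"
      using T by (auto simp: phi_diff)
    then show ?thesis
      using T \<open>\<sigma>0 > 0\<close> \<open>\<nu> > 0\<close> by (intro exI[of _ \<sigma>0] conjI exI[of _ T] exI[of _ \<nu>]) auto
  qed

  \<comment> \<open>Exponential decay of the energy gap\<close>
  define Rates where "Rates \<longleftrightarrow> (\<exists>\<alpha>>0. \<exists>\<beta>>0. \<exists>\<gamma>>0. \<exists>\<tau>>0.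
          (\<lambda>s. set_edist 0 (clarke_subdifferential \<phi> (x s))) \<in> borel_measurable (lebesgue_on {\<tau>..}) \<and>
          (\<forall>t\<ge>\<tau>.
            ereal \<gamma> * enn2ereal
                (\<integral>\<^sup>+ s. (set_edist 0 (clarke_subdifferential \<phi> (x s)))\<^sup>2 \<partial>lebesgue_on {t..})
              \<le> \<phi> (x t) - \<phi> xstar \<and>
            \<phi> (x t) - \<phi> xstar \<le> ereal (\<alpha> * exp (- \<beta> * t))))"
  have rates: Rates
    if T: "T \<ge> 1" and B: "\<And>t. t \<ge> T \<Longrightarrow> x t \<in> B" and C: "C > 0"
      and closed: "\<And>Y y Z \<zeta>. \<lbrakk>y \<in> B; Y \<longlonglongrightarrow> y; Z \<longlonglongrightarrow> \<zeta>; \<And>n. Z n \<in> clarke_subdifferential \<phi> (Y n)\<rbrakk>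
        \<Longrightarrow> \<zeta> \<in> clarke_subdifferential \<phi> y"
      and small: "AE t in lebesgue. t \<ge> T \<longrightarrow> (\<exists>u\<in>clarke_subdifferential \<phi> (x t). norm u \<le> L * speed t)"
      and growth: "AE t in lebesgue. t \<ge> T \<longrightarrow> e t - es \<le> C * (speed t)\<^sup>2" for T B C
  proof -
    have "T \<ge> 0" using T by simp
    have "\<exists>\<alpha>>0. \<exists>\<beta>>0. \<exists>\<gamma>>0.
          (\<lambda>s. set_edist 0 (clarke_subdifferential \<phi> (x s))) \<in> borel_measurable (lebesgue_on {T..}) \<and>
          (\<forall>t\<ge>T. ereal \<gamma> * enn2ereal
              (\<integral>\<^sup>+ s. (set_edist 0 (clarke_subdifferential \<phi> (x s)))\<^sup>2 \<partial>lebesgue_on {t..}) \<le> ereal (e t - es) \<and>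
            e t - es \<le> \<alpha> * exp (- \<beta> * t))"
      by (rule energy_integral_sandwich[where B = B and L = L and C = C])
        (fact \<open>T \<ge> 0\<close> B L(1) C closed small growth)+
    then obtain \<alpha> \<beta> \<gamma> where "\<alpha> > 0" "\<beta> > 0" "\<gamma> > 0"
      "(\<lambda>s. set_edist 0 (clarke_subdifferential \<phi> (x s))) \<in> borel_measurable (lebesgue_on {T..})"
      "\<And>t. t \<ge> T \<Longrightarrow> ereal \<gamma> * enn2ereal
           (\<integral>\<^sup>+ s. (set_edist 0 (clarke_subdifferential \<phi> (x s)))\<^sup>2 \<partial>lebesgue_on {t..}) \<le> ereal (e t - es)"
      "\<And>t. t \<ge> T \<Longrightarrow> e t - es \<le> \<alpha> * exp (- \<beta> * t)"
      by blast
    then show ?thesis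
      unfolding Rates_def using T
      by (intro exI[of _ \<alpha>] exI[of _ \<beta>] exI[of _ \<gamma>] exI[of _ T] conjI allI impI)
        (auto simp: phi_diff_star)
  qed

  \<comment> \<open>Case (i): weakly convex energy\<close>
  have rates_i: Rates if wc: "weakly_convex_around \<sigma> \<phi>1 xstar" and "\<phi>2 = (\<lambda>_. 0)" for \<sigma>
  proof -
    have phi1: "\<phi> = \<phi>1" using that(2) by (simp add: phi)
    have "\<sigma> \<ge> 0" using wc by (simp add: weakly_convex_around_def)
    obtain W where W: "convex W" "xstar \<in> interior W" and wcW: "\<And>y z u. \<lbrakk>y \<in> W; z \<in> W; u \<in> {0..1}\<rbrakk> \<Longrightarrow>
        \<phi> (u *\<^sub>R y + (1 - u) *\<^sub>R z) \<le>
          ereal u * \<phi> y + ereal (1 - u) * \<phi> z + ereal (\<sigma> * (u * (1 - u) / 2) * (norm (y - z))\<^sup>2)"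
      using wc unfolding weakly_convex_around_def phi1 by blast
    obtain T where T: "T \<ge> 1" "\<And>t. t \<ge> T \<Longrightarrow> x t \<in> interior W \<inter> ball xstar r"
      using tail[of "interior W \<inter> ball xstar r"] W r by auto
    have xW: "xstar \<in> W" using W(2) interior_subset by blast
    \<comment> \<open>The first term comes from Cauchy-Schwarz applied to the subgradient and the
      displacement, the second from the convexity defect.\<close>
    define C where "C = L * K + \<sigma> / 2 * K\<^sup>2"
    have "C > 0" unfolding C_def using L K \<open>\<sigma> \<ge> 0\<close> by (intro add_pos_nonneg) auto
    have ae: "AE t in lebesgue. t \<ge> T \<longrightarrow> v t \<in> clarke_subdifferential \<phi> (x t) \<and>
        norm (v t) \<le> L * speed t \<and> norm (x t - xstar) \<le> K * speed t"
      using basic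
    proof eventually_elim
      case (elim t)
      then show ?case
        using T clarke_subdifferential_zero[of "x t"]
        by (auto simp: phi1 \<open>\<phi>2 = (\<lambda>_. 0)\<close> zero_ereal_def)
    qed
    show Rates
    proof (rule rates[OF T \<open>C > 0\<close>])
      show "\<zeta> \<in> clarke_subdifferential \<phi> y"
        if "y \<in> interior W \<inter> ball xstar r" "Y \<longlonglongrightarrow> y" "Z \<longlonglongrightarrow> \<zeta>" "\<And>n. Z n \<in> clarke_subdifferential \<phi> (Y n)" for Y y Z \<zeta>
        using that phi_star
        by (intro clarke_subdifferential_closed_weakly_convex[OF _ phi_minf W(1) wcW xW, of y Y Z \<zeta>])
          (auto simp: phi1 assms(2))
      show "AE t in lebesgue. t \<ge> T \<longrightarrow> (\<exists>u\<in>clarke_subdifferential \<phi> (x t). norm u \<le> L * speed t)"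
        using ae by eventually_elim auto
      show "AE t in lebesgue. t \<ge> T \<longrightarrow> e t - es \<le> C * (speed t)\<^sup>2"
        using ae
      proof eventually_elim
        case (elim t)
        show ?case
        proof
          assume t: "t \<ge> T"
          let ?d = "norm (xstar - x t)"
          have d: "?d \<le> K * speed t" using elim t by (simp add: norm_minus_commute)
          have "e t + inner (v t) (xstar - x t) - \<sigma> / 2 * ?d\<^sup>2 \<le> es"
            unfolding e_def
            by (rule clarke_subdifferential_weakly_convex[OF _ _ phi_minf W(1) wcW xW])
              (use elim t T phi_star in auto)
          moreover have "- inner (v t) (xstar - x t) \<le> norm (v t) * ?d"
            using Cauchy_Schwarz_ineq2[of "v t" "xstar - x t"] by linarith
          moreover have "norm (v t) * ?d \<le> (L * speed t) * (K * speed t)"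
            using elim t d by (intro mult_mono) (auto intro: order_trans[OF norm_ge_zero])
          moreover have "\<sigma> / 2 * ?d\<^sup>2 \<le> \<sigma> / 2 * (K * speed t)\<^sup>2"
            using d \<open>\<sigma> \<ge> 0\<close> by (intro mult_left_mono power_mono) auto
          ultimately have "e t - es \<le> (L * speed t) * (K * speed t) + \<sigma> / 2 * (K * speed t)\<^sup>2"
            by linarith
          also have "\<dots> = C * (speed t)\<^sup>2" by (simp add: C_def power2_eq_square algebra_simps)
          finally show "e t - es \<le> C * (speed t)\<^sup>2" .
        qed
      qed
    qed
  qed

  \<comment> \<open>Case (ii): weakly concave energy\<close>
  have rates_ii: Rates if phi1: "\<phi>1 = (\<lambda>_. 0)" and wc: "weakly_convex_around \<sigma> (\<lambda>y. ereal (- \<phi>2 y)) xstar" for \<sigma>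
  proof -
    have phi2: "\<phi> = (\<lambda>y. ereal (\<phi>2 y))" by (simp add: phi phi1)
    have "\<sigma> \<ge> 0" using wc by (simp add: weakly_convex_around_def)
    obtain W where W: "xstar \<in> interior W" and wcW: "\<And>y z u. \<lbrakk>y \<in> W; z \<in> W; u \<in> {0..1}\<rbrakk> \<Longrightarrow>
        u * \<phi>2 y + (1 - u) * \<phi>2 z \<le> \<phi>2 (u *\<^sub>R y + (1 - u) *\<^sub>R z) + \<sigma> * (u * (1 - u) / 2) * (norm (y - z))\<^sup>2"
    proof -
      obtain W where "xstar \<in> interior W" and *: "\<And>y z u. \<lbrakk>y \<in> W; z \<in> W; u \<in> {0..1}\<rbrakk> \<Longrightarrow>
        ereal (- \<phi>2 (u *\<^sub>R y + (1 - u) *\<^sub>R z)) \<le>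
          ereal u * ereal (- \<phi>2 y) + ereal (1 - u) * ereal (- \<phi>2 z) + ereal (\<sigma> * (u * (1 - u) / 2) * (norm (y - z))\<^sup>2)"
        using wc unfolding weakly_convex_around_def by blast
      then show ?thesis
        by (intro that[of W]) (use * in \<open>fastforce simp: algebra_simps\<close>)+
    qed
    obtain S2 L2 where S2: "open S2" "xstar \<in> S2" "L2-lipschitz_on S2 \<phi>2"
      using locally_lipschitz_on_obtains[OF assms(9,6) \<open>xstar \<in> \<Omega>\<close>] .
    let ?B = "interior W \<inter> S2 \<inter> ball xstar r"
    obtain T where T: "T \<ge> 1" "\<And>t. t \<ge> T \<Longrightarrow> x t \<in> ?B"
      using tail[of ?B] W r S2 by auto
    have ae: "AE t in lebesgue. t \<ge> T \<longrightarrow> w t \<in> clarke_subdifferential \<phi> (x t) \<and>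
        norm (w t) \<le> L * speed t \<and> norm (x t - xstar) \<le> K * speed t"
      using basic
    proof eventually_elim
      case (elim t)
      then show ?case
        using T clarke_subdifferential_zero[of "x t"] by (auto simp: phi1 phi2)
    qed
    have above: "\<phi>2 z \<le> \<phi>2 xstar + \<sigma> / 2 * (norm (z - xstar))\<^sup>2" if "z \<in> W" for z
    proof -
      \<comment> \<open>Slow times are chosen outside the exceptional null set, where
        \<open>w\<close> is a genuine subgradient bounded by the speed; the bound by
        \<open>real n\<close> sends them to infinity.\<close>
      have "\<exists>t\<ge>max T (real n). (t \<ge> T \<longrightarrow> w t \<in> clarke_subdifferential \<phi> (x t) \<and> norm (w t) \<le> L * speed t)
          \<and> speed t < 1 / Suc n" for n
        using ae by (intro exists_slow_time) (auto elim: eventually_mono)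
      then obtain t where t: "\<And>n. t n \<ge> max T (real n)" "\<And>n. speed (t n) < 1 / Suc n"
        "\<And>n. w (t n) \<in> clarke_subdifferential \<phi> (x (t n))" "\<And>n. norm (w (t n)) \<le> L * speed (t n)"
        by (metis max.bounded_iff)
      have "filterlim t at_top sequentially"
        by (rule filterlim_at_top_mono[OF filterlim_real_sequentially]) (use t(1) in auto)
      then have xt: "(\<lambda>n. x (t n)) \<longlonglongrightarrow> xstar" by (rule filterlim_compose[OF lim])
      have wt: "(\<lambda>n. w (t n)) \<longlonglongrightarrow> 0"
      proof (rule Lim_null_comparison)
        have "norm (w (t n)) \<le> L * (1 / Suc n)" for n
          using t(4)[of n] mult_left_mono[OF less_imp_le[OF t(2)[of n]], of L] L by linarith
        then show "\<forall>\<^sub>F n in sequentially. norm (w (t n)) \<le> L * (1 / Suc n)" by simp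
        show "(\<lambda>n. L * (1 / real (Suc n))) \<longlonglongrightarrow> 0"
          using tendsto_mult_right_zero[OF LIMSEQ_Suc[OF lim_inverse_n'], of L] by simp
      qed
      have "isCont \<phi>2 xstar"
        using lipschitz_on_continuous_on[OF S2(3)] S2 by (meson continuous_on_eq_continuous_at)
      then have "(\<lambda>n. \<phi>2 (x (t n)) + inner (w (t n)) (z - x (t n)) + \<sigma> / 2 * (norm (z - x (t n)))\<^sup>2)
          \<longlonglongrightarrow> \<phi>2 xstar + inner 0 (z - xstar) + \<sigma> / 2 * (norm (z - xstar))\<^sup>2"
        by (intro tendsto_intros xt wt isCont_tendsto_compose[of xstar \<phi>2])
      moreover have "\<phi>2 z \<le> \<phi>2 (x (t n)) + inner (w (t n)) (z - x (t n)) + \<sigma> / 2 * (norm (z - x (t n)))\<^sup>2" for n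
        by (rule clarke_subdifferential_weakly_concave[OF _ _ wcW that])
          (use t(1,3)[of n] T(2)[of "t n"] phi2 in auto)
      ultimately have "\<phi>2 z \<le> \<phi>2 xstar + inner 0 (z - xstar) + \<sigma> / 2 * (norm (z - xstar))\<^sup>2"
        by (intro tendsto_lowerbound) auto
      then show ?thesis by simp
    qed
    \<comment> \<open>The \<open>+ 1\<close> keeps \<open>C\<close> positive when
      \<open>\<sigma> = 0\<close>.\<close>
    define C where "C = \<sigma> / 2 * K\<^sup>2 + 1"
    have "C > 0" unfolding C_def using \<open>\<sigma> \<ge> 0\<close> by (intro add_nonneg_pos) auto
    show Rates
    proof (rule rates[OF T \<open>C > 0\<close>])
      show "\<zeta> \<in> clarke_subdifferential \<phi> y"
        if "y \<in> ?B" "Y \<longlonglongrightarrow> y" "Z \<longlonglongrightarrow> \<zeta>" "\<And>n. Z n \<in> clarke_subdifferential \<phi> (Y n)" for Y y Z \<zeta>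
        using that(1) by (intro clarke_subdifferential_closed_lipschitz[OF S2(3,1) _ that(2,3,4)[unfolded phi2], folded phi2]) simp
      show "AE t in lebesgue. t \<ge> T \<longrightarrow> (\<exists>u\<in>clarke_subdifferential \<phi> (x t). norm u \<le> L * speed t)"
        using ae by eventually_elim auto
      show "AE t in lebesgue. t \<ge> T \<longrightarrow> e t - es \<le> C * (speed t)\<^sup>2"
        using ae
      proof eventually_elim
        case (elim t)
        show ?case
        proof
          assume t: "t \<ge> T"
          have "x t \<in> W" using T(2)[OF t] interior_subset by blast
          then have "e t - es \<le> \<sigma> / 2 * (norm (x t - xstar))\<^sup>2"
            using above[of "x t"] by (simp add: e_def es_def phi2)
          also have "\<dots> \<le> \<sigma> / 2 * (K * speed t)\<^sup>2"
            using elim t \<open>\<sigma> \<ge> 0\<close> by (intro mult_left_mono power_mono) auto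
          also have "\<dots> \<le> C * (speed t)\<^sup>2"
            by (simp add: C_def power_mult_distrib algebra_simps)
          finally show "e t - es \<le> C * (speed t)\<^sup>2" .
        qed
      qed
    qed
  qed

  \<comment> \<open>Exponential convergence of the trajectory\<close>
  have last: "\<exists>\<alpha>>0. \<exists>\<beta>>0. \<exists>\<tau>>0. \<forall>t\<ge>\<tau>. norm (x t - xstar) \<le> \<alpha> * exp (- \<beta> * t)" if Rates
    using that unfolding Rates_def
  proof (elim exE conjE)
    fix \<alpha> \<beta> \<gamma> \<tau> :: real
    assume \<alpha>\<beta>: "\<alpha> > 0" "\<beta> > 0" and "\<tau> > 0"
      and H: "\<forall>t\<ge>\<tau>. ereal \<gamma> * enn2ereal
                (\<integral>\<^sup>+ s. (set_edist 0 (clarke_subdifferential \<phi> (x s)))\<^sup>2 \<partial>lebesgue_on {t..})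
              \<le> \<phi> (x t) - \<phi> xstar \<and>
            \<phi> (x t) - \<phi> xstar \<le> ereal (\<alpha> * exp (- \<beta> * t))"
    have "e t - es \<le> \<alpha> * exp (- \<beta> * t)" if "t \<ge> \<tau>" for t
    proof -
      have "\<phi> (x t) - \<phi> xstar \<le> ereal (\<alpha> * exp (- \<beta> * t))" using H that by blast
      moreover have "0 \<le> t" using that \<open>\<tau> > 0\<close> by linarith
      ultimately show ?thesis by (simp only: phi_diff_star ereal_less_eq)
    qed
    then show ?thesis
      using curve_exponential_decay[OF _ lim \<alpha>\<beta>, of \<tau>] \<open>\<tau> > 0\<close> by (metis less_imp_le)
  qed
  show ?thesis
    unfolding Rates_def[symmetric] using lim part2 rates_i rates_ii last by blast
qed

end
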